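(* For all $\lambda,\mu,\nu\in\mathcal{P}_d$, $$c_{\lambda,\mu}^{\nu}=\sum_{L\in\mathcal{LR}_{\lambda,\mu}^{\nu}} c_L .$$
   Context: Fix a positive integer $d$. $\mathbb{N}$ is the set of nonnegative integers; for an integer $m$, $m':=d+1-m$. $\mathcal{P}_d$ is the set of partitions $\lambda=(\lambda_1\geq\cdots\geq\lambda_d)\in\mathbb{N}^d$. For a finite sequence with terms in $\{1,\ldots,d\}$, its content is $\omega=(\xi_1,\ldots,\xi_d)\in\mathbb{N}^d$, where $\xi_k$ is the number of $k$'s in the sequence. Reverse diagrams and factorial Schur functions. To $\mu\in\mathcal{P}_d$ associate its reverse Young diagram, the right- and bottom-justified array of boxes whose bottom row has length $\mu_1$, next-to-bottom row length $\mu_2$, etc. Rows are numbered $1,2,\ldots$ from bottom to top and columns $1,2,\ldots$ from right to left; $r(a)$ and $c(a)$ are the row and column numbers of (the box of) an entry $a$. A reverse tableau of shape $\mu$ is a filling of the boxes by integers in $\{1,\ldots,d\}$ weakly increasing along rows from left to right and strictly increasing down columns from top to bottom; $\mathcal{R}(\mu)$ is the set of these. With variables $x_1,\ldots,x_d$ and $(y_i)_{i\geq1}$, the factorial Schur function is $s_\mu(x\,|\,y)=\sum_{R\in\mathcal{R}(\mu)}\prod_{a\in R}(x_a-y_{a'+c(a)-r(a)})$. The $s_\nu(x\,|\,y)$, $\nu\in\mathcal{P}_d$, form a $\mathbb{C}[y_i]$-basis of $\mathbb{C}[y_i][x_1,\ldots,x_d]^{S_d}$, and $c_{\lambda,\mu}^{\nu}\in\mathbb{C}[y_i]$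 are defined by $s_\lambda(x\,|\,y)s_\mu(x\,|\,y)=\sum_{\nu\in\mathcal{P}_d}c_{\lambda,\mu}^{\nu}s_\nu(x\,|\,y)$. Skew barred tableaux. The skew diagram $\lambda*\mu$ is obtained by placing the ordinary (top-left justified) Young diagram $\lambda$ above and to the right of the reverse Young diagram $\mu$ (so no box of $\lambda$ shares a row or column with a box of $\mu$). A skew barred tableau $L$ of shape $\lambda*\mu$ fills each box of $\lambda$ with an element of $\{1,\ldots,d\}$ and each box of $\mu$ with an element of $\{1,\ldots,d\}\cup\{\bar1,\ldots,\bar d\}$ so that the values, disregarding bars, weakly increase along rows from left to right and strictly increase down columns. $|a|$ denotes the integer value of an entry $a$ (bar disregarded). The unbarred column word $L^u$ is the sequence of unbarred entries of $L$ read column by column, starting with the rightmost column and moving left, each column read from top to bottom, barred entries being skipped. It is Yamanouchi if every initial segment contains at least as many $k$'s as $(k+1)$'s for each $k=1,\ldots,d-1$. The unbarred content of $L$ is $\omega(L^u)$. $\mathcal{LR}_{\lambda,\mu}^{\nu}$ is the set of skew barred tableaux of shape $\lambda*\mu$ whose unbarred column word is Yamanouchi and whose unbarred content is $\nu$. For $a\in L$, $L^u_{<a}$ is the portion of the unbarred column word that comes before reaching $a$ in the reading order. Finally $$c_L=\prod_{a\in L,\ a\text{ barred}}\left(y_{|a|'+\omega(L^u_{<a})_{|a|}}-y_{|a|'+c(a)-r(a)}\right),$$ where $r(a),c(a)$ are the row and column numbers of $a$ in the reverse diagram $\mu$; the empty product is $1$. *)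

theory Defs
  imports Complex_Main "HOL-Library.Poly_Mapping" "HOL-Library.FuncSet" "HOL-Library.Sublist"
begin

section \<open>Partitions, diagrams and fillings\<close>

text \<open>A vector in \<open>\<nat>\<^sup>d\<close> is a function \<open>nat \<Rightarrow> nat\<close>, indexed from 1 and zero off \<open>{1..d}\<close>. In
  particular, the content of a word \<open>w\<close> over \<open>{1..d}\<close> is \<open>count_list w\<close>.
  The partition usually called \<open>\<lambda>\<close> is named \<open>lam\<close>, as \<open>\<lambda>\<close> is a reserved symbol.\<close>

definition partitions :: "nat \<Rightarrow> (nat \<Rightarrow> nat) set" where
  "partitions d =
     {lam. (\<forall>i j. 1 \<le> i \<and> i \<le> j \<and> j \<le> d \<longrightarrow> lam j \<le> lam i) \<and> (\<forall>i. i \<notin> {1..d} \<longrightarrow> lam i = 0)}"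

text \<open>A box is a pair (row, column), both counted from 1. The set \<open>boxes d lam\<close> serves for both kinds
  of diagram: in the ordinary diagram rows are counted from top to bottom and columns from left to
  right, in the reverse diagram rows are counted from bottom to top and columns from right to left.
  The inequalities in the two tableau conditions below are oriented accordingly.\<close>

type_synonym box = "nat \<times> nat"

definition boxes :: "nat \<Rightarrow> (nat \<Rightarrow> nat) \<Rightarrow> box set" where
  "boxes d lam = {(r, c). r \<in> {1..d} \<and> c \<in> {1..lam r}}"

definition increasing_ordinary :: "box set \<Rightarrow> (box \<Rightarrow> nat) \<Rightarrow> bool" where
  "increasing_ordinary D T \<longleftrightarrow>
     (\<forall>r c c'. (r, c) \<in> D \<and> (r, c') \<in> D \<and> c < c' \<longrightarrow> T (r, c) \<le> T (r, c')) \<and>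
     (\<forall>r r' c. (r, c) \<in> D \<and> (r', c) \<in> D \<and> r < r' \<longrightarrow> T (r, c) < T (r', c))"

definition increasing_reverse :: "box set \<Rightarrow> (box \<Rightarrow> nat) \<Rightarrow> bool" where
  "increasing_reverse D T \<longleftrightarrow>
     (\<forall>r c c'. (r, c) \<in> D \<and> (r, c') \<in> D \<and> c < c' \<longrightarrow> T (r, c') \<le> T (r, c)) \<and>
     (\<forall>r r' c. (r, c) \<in> D \<and> (r', c) \<in> D \<and> r < r' \<longrightarrow> T (r', c) < T (r, c))"

definition reverse_tableaux :: "nat \<Rightarrow> (nat \<Rightarrow> nat) \<Rightarrow> (box \<Rightarrow> nat) set" where
  "reverse_tableaux d \<mu> =
     {R \<in> boxes d \<mu> \<rightarrow>\<^sub>E {1..d}. increasing_reverse (boxes d \<mu>) R}"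


section \<open>Factorial Schur functions and their structure constants\<close>

text \<open>\<open>ypoly\<close> is the polynomial ring over \<open>\<complex>\<close> in the variables \<open>y\<^sub>i\<close>, and \<open>xypoly\<close> is the
  polynomial ring over \<open>ypoly\<close> in the variables \<open>x\<^sub>i\<close>: a \<open>nat \<Rightarrow>\<^sub>0 nat\<close> is a monomial
  (a map from variables to exponents), and multiplication on
  \<open>(nat \<Rightarrow>\<^sub>0 nat) \<Rightarrow>\<^sub>0 _\<close> is convolution. Only \<open>y\<^sub>i\<close> with \<open>i \<ge> 1\<close> and \<open>x\<^sub>i\<close> with \<open>1 \<le> i \<le> d\<close> are
  used; the remaining variables are harmless.\<close>

type_synonym ypoly = "(nat \<Rightarrow>\<^sub>0 nat) \<Rightarrow>\<^sub>0 complex"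
type_synonym xypoly = "(nat \<Rightarrow>\<^sub>0 nat) \<Rightarrow>\<^sub>0 ypoly"

definition yvar :: "nat \<Rightarrow> ypoly" where
  "yvar i = Poly_Mapping.single (Poly_Mapping.single i 1) 1"

definition xvar :: "nat \<Rightarrow> xypoly" where
  "xvar i = Poly_Mapping.single (Poly_Mapping.single i 1) 1"

definition const :: "ypoly \<Rightarrow> xypoly" where
  "const p = Poly_Mapping.single 0 p"

text \<open>The index \<open>a' + c(a) - r(a)\<close> with \<open>a' = d + 1 - a\<close>. The subtractions on \<open>nat\<close> do not truncate:
  in a reverse tableau an entry \<open>a\<close> in row \<open>r\<close> has \<open>r - 1\<close> strictly larger entries of \<open>{1..d}\<close> below
  it, so \<open>r \<le> a'\<close> and the index is at least \<open>c(a) \<ge> 1\<close>.\<close>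

definition yindex :: "nat \<Rightarrow> nat \<Rightarrow> box \<Rightarrow> nat" where
  "yindex d a b = (d + 1 - a) + snd b - fst b"

definition factorial_schur :: "nat \<Rightarrow> (nat \<Rightarrow> nat) \<Rightarrow> xypoly" where
  "factorial_schur d \<mu> =
     (\<Sum>R\<in>reverse_tableaux d \<mu>. \<Prod>b\<in>boxes d \<mu>. xvar (R b) - const (yvar (yindex d (R b) b)))"

text \<open>The family \<open>\<nu> \<mapsto> c\<^sub>\<lambda>\<^sub>,\<^sub>\<mu>\<^sup>\<nu>\<close> of coordinates of \<open>s\<^sub>\<lambda>(x|y) s\<^sub>\<mu>(x|y)\<close> with respect to the basis
  \<open>s\<^sub>\<nu>(x|y)\<close>, \<open>\<nu> \<in> partitions d\<close>: the unique finitely supported family of coefficients that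
  expresses the product.\<close>

definition structure_constant ::
    "nat \<Rightarrow> (nat \<Rightarrow> nat) \<Rightarrow> (nat \<Rightarrow> nat) \<Rightarrow> (nat \<Rightarrow> nat) \<Rightarrow> ypoly" where
  "structure_constant d lam \<mu> =
     (THE c. finite {\<nu>. c \<nu> \<noteq> 0} \<and> {\<nu>. c \<nu> \<noteq> 0} \<subseteq> partitions d \<and>
        factorial_schur d lam * factorial_schur d \<mu> =
          (\<Sum>\<nu> | c \<nu> \<noteq> 0. const (c \<nu>) * factorial_schur d \<nu>))"


section \<open>Skew barred tableaux\<close>

datatype entry = Unbarred nat | Barred nat

primrec value_of :: "entry \<Rightarrow> nat" where
  "value_of (Unbarred a) = a"
| "value_of (Barred a) = a"

primrec is_barred :: "entry \<Rightarrow> bool" where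
  "is_barred (Unbarred a) = False"
| "is_barred (Barred a) = True"

text \<open>A filling of \<open>lam * \<mu>\<close> is a pair consisting of a filling of the ordinary diagram \<open>lam\<close> and a
  filling of the reverse diagram \<open>\<mu>\<close>. Since these share no row or column, the monotonicity
  conditions for the skew diagram are those for the two parts.\<close>

type_synonym skew_filling = "(box \<Rightarrow> nat) \<times> (box \<Rightarrow> entry)"

definition skew_barred_tableaux ::
    "nat \<Rightarrow> (nat \<Rightarrow> nat) \<Rightarrow> (nat \<Rightarrow> nat) \<Rightarrow> skew_filling set" where
  "skew_barred_tableaux d lam \<mu> =
     {(T, U). T \<in> boxes d lam \<rightarrow>\<^sub>E {1..d} \<and> increasing_ordinary (boxes d lam) T \<and>
              U \<in> boxes d \<mu> \<rightarrow>\<^sub>E Unbarred ` {1..d} \<union> Barred ` {1..d} \<and>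
              increasing_reverse (boxes d \<mu>) (value_of \<circ> U)}"

text \<open>The boxes of a diagram in reading order: columns from right to left, each from top to
  bottom. As \<open>lam\<close> lies to the right of \<open>\<mu>\<close>, all boxes of \<open>lam\<close> are read before those of \<open>\<mu>\<close>.\<close>

definition reading_ordinary :: "nat \<Rightarrow> (nat \<Rightarrow> nat) \<Rightarrow> box list" where
  "reading_ordinary d lam = [(r, c). c \<leftarrow> rev [1..<lam 1 + 1], r \<leftarrow> [1..<d + 1], c \<le> lam r]"

definition reading_reverse :: "nat \<Rightarrow> (nat \<Rightarrow> nat) \<Rightarrow> box list" where
  "reading_reverse d \<mu> = [(r, c). c \<leftarrow> [1..<\<mu> 1 + 1], r \<leftarrow> rev [1..<d + 1], c \<le> \<mu> r]"

definition unbarred_entries :: "(box \<Rightarrow> entry) \<Rightarrow> box list \<Rightarrow> nat list" where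
  "unbarred_entries U bs = map (value_of \<circ> U) (filter (\<lambda>b. \<not> is_barred (U b)) bs)"

definition unbarred_word :: "nat \<Rightarrow> (nat \<Rightarrow> nat) \<Rightarrow> (nat \<Rightarrow> nat) \<Rightarrow> skew_filling \<Rightarrow> nat list" where
  "unbarred_word d lam \<mu> = (\<lambda>(T, U).
     map T (reading_ordinary d lam) @ unbarred_entries U (reading_reverse d \<mu>))"

definition unbarred_word_before ::
    "nat \<Rightarrow> (nat \<Rightarrow> nat) \<Rightarrow> (nat \<Rightarrow> nat) \<Rightarrow> skew_filling \<Rightarrow> box \<Rightarrow> nat list" where
  \<comment> \<open>the part of the unbarred word read before reaching the box \<open>b\<close> of \<open>\<mu>\<close>\<close>
  "unbarred_word_before d lam \<mu> = (\<lambda>(T, U) b.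
     map T (reading_ordinary d lam) @
     unbarred_entries U (takeWhile (\<lambda>b'. b' \<noteq> b) (reading_reverse d \<mu>)))"

definition yamanouchi :: "nat \<Rightarrow> nat list \<Rightarrow> bool" where
  "yamanouchi d w \<longleftrightarrow> (\<forall>u. prefix u w \<longrightarrow> (\<forall>k\<in>{1..<d}. count_list u (k + 1) \<le> count_list u k))"

definition LR_tableaux ::
    "nat \<Rightarrow> (nat \<Rightarrow> nat) \<Rightarrow> (nat \<Rightarrow> nat) \<Rightarrow> (nat \<Rightarrow> nat) \<Rightarrow> skew_filling set" where
  "LR_tableaux d lam \<mu> \<nu> =
     {L \<in> skew_barred_tableaux d lam \<mu>.
        yamanouchi d (unbarred_word d lam \<mu> L) \<and> count_list (unbarred_word d lam \<mu> L) = \<nu>}"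

definition tableau_weight ::
    "nat \<Rightarrow> (nat \<Rightarrow> nat) \<Rightarrow> (nat \<Rightarrow> nat) \<Rightarrow> skew_filling \<Rightarrow> ypoly" where
  "tableau_weight d lam \<mu> L =
     (\<Prod>b | b \<in> boxes d \<mu> \<and> is_barred (snd L b).
        let a = value_of (snd L b) in
          yvar ((d + 1 - a) + count_list (unbarred_word_before d lam \<mu> L b) a) - yvar (yindex d a b))"

end

theory Submission
  imports Defs "HOL-Combinatorics.Permutations"
begin

text \<open>
Write \<open>(u|y)\<^sup>p = (u - y\<^sub>1)\<cdots>(u - y\<^sub>p)\<close> and, for an exponent vector \<open>\<alpha>\<close>, let \<open>A\<^sub>\<alpha>\<close> be the
alternating sum over \<open>w\<close> in the symmetric group of \<open>\<Prod>\<^sub>j (x\<^sub>w\<^sub>(\<^sub>j\<^sub>)|y)\<close> to the power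
\<open>\<alpha>\<^sub>j + d - j\<close>. A polynomial \<open>F\<close>, permuted along with the variables, can be inserted into this sum.
The identity \<open>(u|y)\<^sup>p (u - c) = (u|y)\<^sup>p\<^sup>+\<^sup>1 + (y\<^sub>p\<^sub>+\<^sub>1 - c) (u|y)\<^sup>p\<close> says what happens to an inserted
factor \<open>x\<^sub>a - c\<close>: either it raises \<open>\<alpha>\<^sub>a\<close> by one, or it leaves \<open>\<alpha>\<close> alone and costs the
scalar \<open>y\<close> of index \<open>a' + \<alpha>\<^sub>a\<close>, minus \<open>c\<close> (\<open>alternant_mult_linear\<close>). These are the two roles
of an entry \<open>a\<close> of a barred tableau, unbarred and barred, and the scalar is its factor of the weight.
Applied box by box in reading order to the tableaux of shape \<open>\<mu>\<close>, the identity expands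
\<open>A\<^sub>\<lambda> s\<^sub>\<mu>\<close> as a sum of \<open>c\<^sub>L A\<^sub>\<nu>\<close> over all barred fillings of \<open>\<mu>\<close>, with \<open>\<nu>\<close> equal to \<open>\<lambda>\<close> plus
the unbarred content.

The fillings whose word is not Yamanouchi cancel. At the first unbarred entry \<open>k + 1\<close> that makes
\<open>\<lambda>\<close> plus the content fail to be a partition, the exponents at \<open>k\<close> and \<open>k + 1\<close> agree. The
alternating sum then vanishes, provided that the sum over all ways to complete the part of the
tableau read so far is symmetric in \<open>x\<^sub>k\<close> and \<open>x\<^sub>k\<^sub>+\<^sub>1\<close> (\<open>alternant_eq_0\<close>,
\<open>completion_sum_symmetric\<close>). The usual Bender-Knuth involution does not preserve the weights in
\<open>y\<close>, so the symmetry is proved for sums instead: tableaux are grouped by the filling that results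
when \<open>k + 1\<close> is replaced by \<open>k\<close>. In each group the sum is a product over rows, and a row with
\<open>m\<close> free boxes contributes the complete homogeneous factorial polynomial of degree \<open>m\<close> in two
variables, which is symmetric (\<open>two_letter_row_symmetric\<close>). The result is the expansion
\<open>alternant_schur_expansion\<close>.

For \<open>\<lambda> = 0\<close> all Yamanouchi fillings but one have weight zero, which gives the bialternant formula
\<open>A\<^sub>0 s\<^sub>\<mu> = A\<^sub>\<mu>\<close> (\<open>bialternant\<close>). As \<open>s\<^sub>\<mu>\<close> is symmetric, \<open>A\<^sub>0 s\<^sub>\<lambda> s\<^sub>\<mu>\<close> is the expanded
alternating sum, and cancelling \<open>A\<^sub>0\<close> yields \<open>s\<^sub>\<lambda> s\<^sub>\<mu>\<close> as a combination of factorial Schur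
functions (\<open>schur_product\<close>). Its coefficients are the structure constants because the \<open>A\<^sub>\<nu>\<close>
are linearly independent: at the point \<open>x\<^sub>j = y\<close> of index \<open>\<kappa>\<^sub>j + d - j + 1\<close>, the value of \<open>A\<^sub>\<nu>\<close>
vanishes unless \<open>\<nu> \<subseteq> \<kappa>\<close>, and it does not vanish for \<open>\<nu> = \<kappa>\<close>
(\<open>alternants_independent\<close>). Finally, the Yamanouchi condition forces row \<open>i\<close> of the \<open>\<lambda>\<close> part of a
skew tableau to consist of \<open>i\<close>'s, so that only the filling of \<open>\<mu>\<close> varies (\<open>LR_tableaux_eq\<close>).
\<close>

section \<open>Factorial alternants\<close>

text \<open>The factorial power \<open>(u|y)\<^sup>p\<close>.\<close>

definition ypow :: "(nat \<Rightarrow> 'a::comm_ring_1) \<Rightarrow> 'a \<Rightarrow> nat \<Rightarrow> 'a" where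
  "ypow y u p = (\<Prod>i\<in>{1..p}. u - y i)"

lemma ypow_Suc: "ypow y u (Suc p) = ypow y u p * (u - y (Suc p))"
  by (simp add: ypow_def)

text \<open>For \<open>F = 1\<close> this is the determinant with entries \<open>(x\<^sub>i|y)\<close> to the power \<open>\<alpha>\<^sub>j + d - j\<close>. The
polynomial \<open>F\<close> sits inside the sum because the partial expansions below concern polynomials that are
not symmetric and hence cannot be taken out of it.\<close>

definition alternant ::
    "nat \<Rightarrow> (nat \<Rightarrow> 'a) \<Rightarrow> (nat \<Rightarrow> nat) \<Rightarrow> ((nat \<Rightarrow> 'a) \<Rightarrow> 'a) \<Rightarrow> (nat \<Rightarrow> 'a) \<Rightarrow> 'a::comm_ring_1" where
  "alternant d y \<alpha> F x =
     (\<Sum>w | w permutes {1..d}.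
        of_int (sign w) * (\<Prod>j\<in>{1..d}. ypow y (x (w j)) (\<alpha> j + d - j)) * F (x \<circ> w))"

lemma alternant_sum:
  "alternant d y \<alpha> (\<lambda>z. \<Sum>i\<in>I. F i z) x = (\<Sum>i\<in>I. alternant d y \<alpha> (F i) x)"
  unfolding alternant_def by (subst sum.swap) (simp add: sum_distrib_left)

lemma alternant_zero: "alternant d y \<alpha> (\<lambda>z. 0) x = 0"
  by (simp add: alternant_def)

text \<open>The term for \<open>w\<close> contains \<open>(u|y)\<^sup>p\<close> with \<open>u = x\<^sub>w\<^sub>(\<^sub>a\<^sub>)\<close> and \<open>p = \<alpha>\<^sub>a + d - a\<close>, and
\<open>u - c = (u - y\<^sub>p\<^sub>+\<^sub>1) + (y\<^sub>p\<^sub>+\<^sub>1 - c)\<close>. The first summand raises the exponent, the second is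
the factor of a barred entry \<open>a\<close>, since \<open>p + 1 = a' + \<alpha>\<^sub>a\<close>.\<close>

lemma alternant_mult_linear:
  assumes a: "a \<in> {1..d}"
  shows "alternant d y \<alpha> (\<lambda>z. (z a - c) * F z) x =
           alternant d y (\<alpha>(a := \<alpha> a + 1)) F x + (y ((d + 1 - a) + \<alpha> a) - c) * alternant d y \<alpha> F x"
proof -
  have step: "(\<Prod>j\<in>{1..d}. ypow y (x (w j)) (\<alpha> j + d - j)) * (x (w a) - c) =
      (\<Prod>j\<in>{1..d}. ypow y (x (w j)) ((\<alpha>(a := \<alpha> a + 1)) j + d - j)) +
      (y ((d + 1 - a) + \<alpha> a) - c) * (\<Prod>j\<in>{1..d}. ypow y (x (w j)) (\<alpha> j + d - j))" for w
  proof -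
    define P where "P = (\<Prod>j\<in>{1..d} - {a}. ypow y (x (w j)) (\<alpha> j + d - j))"
    have 1: "(\<Prod>j\<in>{1..d}. ypow y (x (w j)) (\<alpha> j + d - j)) = ypow y (x (w a)) (\<alpha> a + d - a) * P"
      unfolding P_def by (rule prod.remove) (use a in auto)
    have "(\<Prod>j\<in>{1..d}. ypow y (x (w j)) ((\<alpha>(a := \<alpha> a + 1)) j + d - j)) =
        ypow y (x (w a)) (\<alpha> a + 1 + d - a) *
        (\<Prod>j\<in>{1..d} - {a}. ypow y (x (w j)) ((\<alpha>(a := \<alpha> a + 1)) j + d - j))"
      by (subst prod.remove[of _ a]) (use a in auto)
    also have "(\<Prod>j\<in>{1..d} - {a}. ypow y (x (w j)) ((\<alpha>(a := \<alpha> a + 1)) j + d - j)) = P"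
      unfolding P_def by (rule prod.cong) auto
    also have "\<alpha> a + 1 + d - a = Suc (\<alpha> a + d - a)"
      using a by auto
    also have "ypow y (x (w a)) (Suc (\<alpha> a + d - a)) =
        ypow y (x (w a)) (\<alpha> a + d - a) * (x (w a) - y ((d + 1 - a) + \<alpha> a))"
      using a by (simp add: ypow_Suc Suc_diff_le add.commute)
    finally show ?thesis
      unfolding 1 by (simp add: algebra_simps)
  qed
  have "of_int (sign w) * (\<Prod>j\<in>{1..d}. ypow y (x (w j)) (\<alpha> j + d - j)) * ((x (w a) - c) * F (x \<circ> w)) =
      of_int (sign w) * (\<Prod>j\<in>{1..d}. ypow y (x (w j)) ((\<alpha>(a := \<alpha> a + 1)) j + d - j)) * F (x \<circ> w) +
      (y ((d + 1 - a) + \<alpha> a) - c) *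
      (of_int (sign w) * (\<Prod>j\<in>{1..d}. ypow y (x (w j)) (\<alpha> j + d - j)) * F (x \<circ> w))" for w
  proof -
    have "of_int (sign w) * (\<Prod>j\<in>{1..d}. ypow y (x (w j)) (\<alpha> j + d - j)) * ((x (w a) - c) * F (x \<circ> w)) =
        of_int (sign w) * F (x \<circ> w) *
        ((\<Prod>j\<in>{1..d}. ypow y (x (w j)) (\<alpha> j + d - j)) * (x (w a) - c))"
      by (simp only: mult_ac)
    then show ?thesis
      unfolding step by (simp only: distrib_left mult_ac)
  qed
  then show ?thesis
    unfolding alternant_def by (simp add: sum.distrib sum_distrib_left)
qed

lemma prod_transpose_equal_values:
  fixes f :: "nat \<Rightarrow> nat \<Rightarrow> 'a::comm_ring_1"
  assumes "k \<in> {1..d}" "Suc k \<in> {1..d}" "e k = e (Suc k)"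
  shows "(\<Prod>j\<in>{1..d}. f (w (transpose k (Suc k) j)) (e j)) = (\<Prod>j\<in>{1..d}. f (w j) (e j))"
proof -
  let ?t = "transpose k (Suc k)"
  have "?t permutes {1..d}"
    using assms by (intro permutes_swap_id) auto
  then have "(\<Prod>j\<in>{1..d}. f (w j) (e j)) = (\<Prod>j\<in>{1..d}. f (w (?t j)) (e (?t j)))"
    by (rule permutes_imp_bij[THEN prod.reindex_bij_betw, symmetric])
  moreover have "e (?t j) = e j" for j
    using assms(3) by (auto simp: transpose_def)
  ultimately show ?thesis by simp
qed

text \<open>Composing \<open>w\<close> with the transposition of \<open>k\<close> and \<open>k + 1\<close> changes only the sign of its term.\<close>

lemma alternant_eq_0:
  fixes x :: "nat \<Rightarrow> 'a::{idom,ring_char_0}"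
  assumes k: "k \<in> {1..d}" "Suc k \<in> {1..d}"
    and eq: "\<alpha> k + d - k = \<alpha> (Suc k) + d - Suc k"
    and F: "\<And>z. F (z \<circ> transpose k (Suc k)) = F z"
  shows "alternant d y \<alpha> F x = 0"
proof -
  let ?t = "transpose k (Suc k)"
  let ?g = "\<lambda>w. of_int (sign w) * (\<Prod>j\<in>{1..d}. ypow y (x (w j)) (\<alpha> j + d - j)) * F (x \<circ> w)"
  have t: "?t permutes {1..d}"
    using k by (intro permutes_swap_id) auto
  have "alternant d y \<alpha> F x = (\<Sum>w | w permutes {1..d}. ?g (w \<circ> ?t))"
    unfolding alternant_def using sum_permutations_compose_right[OF t, of ?g] by simp
  also have "\<dots> = (\<Sum>w | w permutes {1..d}. - ?g w)"
  proof (rule sum.cong[OF refl])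
    fix w :: "nat \<Rightarrow> nat"
    assume "w \<in> {w. w permutes {1..d}}"
    then have "permutation w" "permutation ?t"
      using t permutation_permutes by blast+
    then have "sign (w \<circ> ?t) = - sign w"
      by (simp add: sign_compose sign_swap_id)
    moreover have "F (x \<circ> (w \<circ> ?t)) = F (x \<circ> w)"
      using F[of "x \<circ> w"] by (simp add: o_assoc)
    moreover have "(\<Prod>j\<in>{1..d}. ypow y (x ((w \<circ> ?t) j)) (\<alpha> j + d - j)) =
        (\<Prod>j\<in>{1..d}. ypow y (x (w j)) (\<alpha> j + d - j))"
      using prod_transpose_equal_values[OF k, of "\<lambda>j. \<alpha> j + d - j" "\<lambda>i. ypow y (x i)" w] eq by simp
    ultimately show "?g (w \<circ> ?t) = - ?g w" by simp
  qed
  also have "\<dots> = - alternant d y \<alpha> F x"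
    unfolding alternant_def by (simp add: sum_negf)
  finally have "2 * alternant d y \<alpha> F x = 0"
    by (simp add: eq_neg_iff_add_eq_0)
  then show ?thesis by simp
qed

lemma symmetric_if_adjacent:
  assumes adj: "\<And>k z. k \<in> {1..d} \<Longrightarrow> Suc k \<in> {1..d} \<Longrightarrow> F (z \<circ> transpose k (Suc k)) = F z"
    and w: "w permutes {1..d}"
  shows "F (x \<circ> w) = F x"
proof -
  have seq: "F (z \<circ> apply_adj_transps ks) = F z" if "set ks \<subseteq> {1..<d}" for ks z
    using that
  proof (induction ks arbitrary: z)
    case (Cons k ks)
    have "F (z \<circ> apply_adj_transps (k # ks)) = F ((z \<circ> transpose k (Suc k)) \<circ> apply_adj_transps ks)"
      by (simp add: o_assoc)
    also have "\<dots> = F (z \<circ> transpose k (Suc k))"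
      by (rule Cons.IH) (use Cons.prems in auto)
    also have "\<dots> = F z"
      by (rule adj) (use Cons.prems in auto)
    finally show ?case .
  qed simp
  have less: "F (z \<circ> transpose a b) = F z" if "a \<in> {1..d}" "b \<in> {1..d}" "a < b" for a b z
    using seq[of "adj_transp_seq a b" z] that
    by (auto simp: adj_transp_seq_correct set_adj_transp_seq)
  have tr: "F (z \<circ> transpose a b) = F z" if "a \<in> {1..d}" "b \<in> {1..d}" "a \<noteq> b" for a b z
    using less[of a b] less[of b a] that by (metis linorder_neqE_nat transpose_commute)
  show ?thesis
    using w finite_atLeastAtMost
  proof (induction arbitrary: x rule: permutes_induct)
    case (swap a b p)
    have "F (x \<circ> (transpose a b \<circ> p)) = F ((x \<circ> transpose a b) \<circ> p)"
      by (simp add: o_assoc)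
    then show ?case
      using swap.IH[of "x \<circ> transpose a b"] tr[OF swap.hyps(1-3), of x] by (simp only:)
  qed simp
qed

lemma alternant_symmetric:
  assumes "\<And>w z. w permutes {1..d} \<Longrightarrow> F (z \<circ> w) = F z"
  shows "alternant d y \<alpha> F x = alternant d y \<alpha> (\<lambda>_. 1) x * F x"
  unfolding alternant_def sum_distrib_right using assms by (intro sum.cong) auto

section \<open>Symmetry in two adjacent variables\<close>

text \<open>The sum runs over the fillings of a row of \<open>m\<close> boxes with two letters, \<open>t\<close> being the number of
boxes that carry the larger one, with variable \<open>v\<close>. The index of \<open>z\<close> drops by one from the smaller
letter to the larger one in the same box. Times \<open>u - v\<close> the sum is antisymmetric, so it is itself
symmetric.\<close>

lemma two_letter_row_closed_form:
  fixes u v :: "'a::comm_ring_1"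
  shows "(u - v) * (\<Sum>t\<le>m. (\<Prod>i<t. v - z i) * (\<Prod>i\<in>{t..<m}. u - z (Suc i))) =
           (\<Prod>i<Suc m. u - z i) - (\<Prod>i<Suc m. v - z i)"
proof (induction m)
  case (Suc m)
  define H where "H = (\<lambda>m. \<Sum>t\<le>m. (\<Prod>i<t. v - z i) * (\<Prod>i\<in>{t..<m}. u - z (Suc i)))"
  have IH: "(u - v) * H m = (\<Prod>i<Suc m. u - z i) - (\<Prod>i<Suc m. v - z i)"
    unfolding H_def by (rule Suc.IH)
  have "H (Suc m) = H m * (u - z (Suc m)) + (\<Prod>i<Suc m. v - z i)"
    by (simp add: H_def sum_distrib_right mult.assoc)
  then have "(u - v) * H (Suc m) =
      ((u - v) * H m) * (u - z (Suc m)) + (u - v) * (\<Prod>i<Suc m. v - z i)"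
    by (simp only: distrib_left mult.assoc)
  also have "\<dots> = (\<Prod>i<Suc (Suc m). u - z i) - (\<Prod>i<Suc (Suc m). v - z i)"
    unfolding IH by (simp only: prod.lessThan_Suc[of _ "Suc m"] algebra_simps)
  finally show ?case
    unfolding H_def .
qed simp

lemma two_letter_row_symmetric:
  fixes u v :: "'a::idom"
  shows "(\<Sum>t\<le>m. (\<Prod>i<t. v - z i) * (\<Prod>i\<in>{t..<m}. u - z (Suc i))) =
           (\<Sum>t\<le>m. (\<Prod>i<t. u - z i) * (\<Prod>i\<in>{t..<m}. v - z (Suc i)))" (is "?H u v = ?H v u")
proof (cases "u = v")
  case False
  have "(u - v) * ?H u v = - ((v - u) * ?H v u)"
    unfolding two_letter_row_closed_form by simp
  also have "\<dots> = (u - v) * ?H v u"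
    by (simp add: algebra_simps)
  finally show ?thesis
    using False by simp
qed simp

lemma finite_boxes: "finite (boxes d \<mu>)"
proof -
  have "boxes d \<mu> = (SIGMA r:{1..d}. {1..\<mu> r})"
    by (auto simp: boxes_def)
  then show ?thesis by simp
qed

lemma boxes_downward_closed:
  assumes "\<mu> \<in> partitions d" "(r, c) \<in> boxes d \<mu>" "1 \<le> r'" "r' \<le> r" "1 \<le> c'" "c' \<le> c"
  shows "(r', c') \<in> boxes d \<mu>"
proof -
  have "\<mu> r \<le> \<mu> r'"
    using assms by (auto simp: partitions_def boxes_def)
  then show ?thesis
    using assms by (auto simp: boxes_def)
qed

lemma finite_reverse_tableaux: "finite (reverse_tableaux d \<mu>)"
  unfolding reverse_tableaux_def
  by (rule finite_subset[of _ "boxes d \<mu> \<rightarrow>\<^sub>E {1..d}"]) (auto intro: finite_PiE finite_boxes)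

lemma reverse_tableau_row:
  assumes "R \<in> reverse_tableaux d \<mu>" "(r, c) \<in> boxes d \<mu>" "(r, c') \<in> boxes d \<mu>" "c \<le> c'"
  shows "R (r, c') \<le> R (r, c)"
  using assms by (cases "c = c'") (auto simp: reverse_tableaux_def increasing_reverse_def)

lemma reverse_tableau_column:
  assumes "R \<in> reverse_tableaux d \<mu>" "(r, c) \<in> boxes d \<mu>" "(r', c) \<in> boxes d \<mu>" "r < r'"
  shows "R (r', c) < R (r, c)"
  using assms by (auto simp: reverse_tableaux_def increasing_reverse_def)

lemma convex_finite_set_eq_interval:
  fixes A :: "nat set"
  assumes "finite A" and "\<And>a b c. a \<in> A \<Longrightarrow> c \<in> A \<Longrightarrow> a \<le> b \<Longrightarrow> b \<le> c \<Longrightarrow> b \<in> A"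
    and "0 \<notin> A"
  shows "\<exists>p. A = {Suc p..p + card A}"
proof (cases "A = {}")
  case False
  define p where "p = Min A - 1"
  have "Min A \<in> A" "Max A \<in> A"
    using False assms(1) by auto
  moreover from this have "Min A \<noteq> 0"
    using assms(3) by metis
  ultimately have M: "Min A \<in> A" "Max A \<in> A" "Min A \<noteq> 0" by auto
  have A: "A = {Min A..Max A}"
  proof (intro set_eqI iffI)
    fix b assume "b \<in> {Min A..Max A}"
    then show "b \<in> A"
      using assms(2)[OF M(1,2)] by simp
  qed (use assms(1) in simp)
  have "card A = Suc (Max A) - Min A"
    by (subst A) simp
  moreover have "Min A \<le> Max A"
    using False assms(1) by simp
  ultimately have "{Suc p..p + card A} = {Min A..Max A}"
    using M(3) by (simp add: p_def)
  then have "A = {Suc p..p + card A}"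
    using A by simp
  then show ?thesis ..
qed auto

text \<open>A tableau \<open>R0\<close> whose values on \<open>Z\<close> are fixed. Call the boxes outside \<open>Z\<close> with value \<open>k\<close> or
\<open>k + 1\<close> active. The conditions on \<open>Z\<close> make sure that exchanging the two letters in active boxes never
conflicts with the fixed part. No column contains both a fixed box and an active one. The fixed boxes in the
row of an active box lie to the right of it, and each of them either has a value that bounds both
letters, or the active box is forced to carry \<open>k\<close> anyway, as the box below it carries \<open>k + 1\<close>.\<close>

locale two_letters =
  fixes d :: nat and \<mu> :: "nat \<Rightarrow> nat" and k :: nat and Z :: "box set" and R0 :: "box \<Rightarrow> nat"
  assumes partition: "\<mu> \<in> partitions d"
    and k: "1 \<le> k" "Suc k \<le> d"
    and tableau: "R0 \<in> reverse_tableaux d \<mu>"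
    and Z_column: "\<And>r r' c. (r, c) \<in> boxes d \<mu> - Z \<Longrightarrow> R0 (r, c) \<in> {k, Suc k} \<Longrightarrow> (r', c) \<notin> Z"
    and Z_row: "\<And>r c c'. (r, c) \<in> boxes d \<mu> - Z \<Longrightarrow> R0 (r, c) \<in> {k, Suc k} \<Longrightarrow>
       (r, c') \<in> Z \<Longrightarrow> c' < c \<and>
       (Suc k \<le> R0 (r, c') \<or> (r - 1, c) \<in> boxes d \<mu> \<and> R0 (r - 1, c) = Suc k)"
begin

abbreviation D where "D \<equiv> boxes d \<mu>"

text \<open>An active box above or below another active box has no choice: the upper one of the pair carries
\<open>k\<close> and the lower one \<open>k + 1\<close>. Rows being counted upwards, the partner of an upper box \<open>(r, c)\<close> is
\<open>(r - 1, c)\<close> and that of a lower one \<open>(Suc r, c)\<close>. All other active boxes are free.\<close>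

definition active where "active = {b \<in> D - Z. R0 b \<in> {k, Suc k}}"
definition upper where "upper = {(r, c). (r, c) \<in> active \<and> (r - 1, c) \<in> active \<and> 1 \<le> r}"
definition lower where "lower = {(r, c). (r, c) \<in> active \<and> (Suc r, c) \<in> active}"
definition free where "free = active - upper - lower"

lemma active_D: "(r, c) \<in> active \<Longrightarrow> (r, c) \<in> D"
  by (simp add: active_def)

lemma active_value: "(r, c) \<in> active \<Longrightarrow> R0 (r, c) = k \<or> R0 (r, c) = Suc k"
  by (auto simp: active_def)

lemma D_pos: "(r, c) \<in> D \<Longrightarrow> 1 \<le> r \<and> 1 \<le> c"
  by (auto simp: boxes_def)

lemma down: "(r, c) \<in> D \<Longrightarrow> 1 \<le> r' \<Longrightarrow> r' \<le> r \<Longrightarrow> 1 \<le> c' \<Longrightarrow> c' \<le> c \<Longrightarrow> (r', c') \<in> D"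
  using boxes_downward_closed[OF partition] by blast

lemmas row = reverse_tableau_row[OF tableau]
lemmas column = reverse_tableau_column[OF tableau]

lemma same_column_active:
  assumes "(r, c) \<in> active" "(r', c) \<in> D" "R0 (r', c) \<in> {k, Suc k}"
  shows "(r', c) \<in> active"
  using assms Z_column[of r c r'] by (auto simp: active_def)

lemma upperI:
  assumes "(r, c) \<in> active" "(r', c) \<in> D" "r' < r" "R0 (r', c) \<le> Suc k"
  shows "(r, c) \<in> upper"
proof -
  have D: "(r - 1, c) \<in> D" "(r, c) \<in> D"
    using assms down[of r c "r - 1" c] D_pos[of r' c] active_D by auto
  have "r' = r - 1 \<or> r' < r - 1"
    using assms by auto
  then have "R0 (r - 1, c) \<le> R0 (r', c)"
    using column[of r' c "r - 1"] assms(2) D(1) by auto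
  moreover have "R0 (r, c) < R0 (r - 1, c)"
    by (rule column) (use assms D in auto)
  ultimately have "R0 (r - 1, c) \<in> {k, Suc k}"
    using assms(4) active_value[OF assms(1)] by auto
  then show ?thesis
    using same_column_active[OF assms(1) D(1)] assms by (auto simp: upper_def)
qed

lemma lowerI:
  assumes "(r, c) \<in> active" "(r', c) \<in> D" "r < r'" "k \<le> R0 (r', c)"
  shows "(r, c) \<in> lower"
proof -
  have D: "(Suc r, c) \<in> D" "(r, c) \<in> D"
    using assms down[of r' c "Suc r" c] D_pos[of r' c] active_D by auto
  have "R0 (r', c) \<le> R0 (Suc r, c)"
    using column[of "Suc r" c r'] assms D by (cases "r' = Suc r") auto
  moreover have "R0 (Suc r, c) < R0 (r, c)"
    by (rule column) (use assms D in auto)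
  ultimately have "R0 (Suc r, c) \<in> {k, Suc k}"
    using assms(4) active_value[OF assms(1)] by auto
  then show ?thesis
    using same_column_active[OF assms(1) D(1)] assms by (auto simp: lower_def)
qed

lemma upper_value: assumes "(r, c) \<in> upper" shows "R0 (r, c) = k"
proof -
  have "(r, c) \<in> active" "(r - 1, c) \<in> active" "1 \<le> r"
    using assms by (auto simp: upper_def)
  moreover from this have "R0 (r, c) < R0 (r - 1, c)"
    by (intro column active_D) auto
  ultimately show ?thesis
    using active_value[of r c] active_value[of "r - 1" c] by auto
qed

lemma lower_value: assumes "(r, c) \<in> lower" shows "R0 (r, c) = Suc k"
proof -
  have "(r, c) \<in> active" "(Suc r, c) \<in> active"
    using assms by (auto simp: lower_def)
  moreover from this have "R0 (Suc r, c) < R0 (r, c)"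
    by (intro column active_D) auto
  ultimately show ?thesis
    using active_value[of r c] active_value[of "Suc r" c] by auto
qed

text \<open>In each row, the active boxes with a partner below lie at the left end (large column numbers), those
with a partner above at the right end. So the free boxes of a row form an interval.\<close>

lemma upper_left:
  assumes "(r, c) \<in> upper" "(r, c') \<in> active" "c \<le> c'"
  shows "(r, c') \<in> upper"
proof -
  have active: "(r, c) \<in> active" "(r - 1, c) \<in> active" "1 \<le> r"
    using assms by (auto simp: upper_def)
  have r: "1 \<le> r - 1"
    using D_pos active_D active(2) by blast
  have D: "(r - 1, c') \<in> D"
    by (rule down[OF active_D[OF assms(2)]]) (use r D_pos[OF active_D[OF assms(2)]] in auto)
  have "R0 (r - 1, c') \<le> R0 (r - 1, c)"
    by (rule row) (use active_D active(2) D assms in auto)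
  also have "\<dots> \<le> Suc k"
    using active_value[OF active(2)] by auto
  finally show ?thesis
    using upperI[OF assms(2) D] r by auto
qed

lemma lower_right:
  assumes "(r, c) \<in> lower" "(r, c') \<in> active" "c' \<le> c"
  shows "(r, c') \<in> lower"
proof -
  have active: "(r, c) \<in> active" "(Suc r, c) \<in> active"
    using assms by (auto simp: lower_def)
  have D: "(Suc r, c') \<in> D"
    by (rule down[OF active_D[OF active(2)]]) (use D_pos[OF active_D[OF assms(2)]] assms(3) in auto)
  have "R0 (Suc r, c) \<le> R0 (Suc r, c')"
    by (rule row) (use active_D active(2) D assms in auto)
  moreover have "k \<le> R0 (Suc r, c)"
    using active_value[OF active(2)] by auto
  ultimately show ?thesis
    using lowerI[OF assms(2) D] by auto
qed

lemma row_between_active: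
  assumes "(r, c1) \<in> active" "(r, c3) \<in> active" "c1 \<le> c2" "c2 \<le> c3"
  shows "(r, c2) \<in> active"
proof -
  have D: "(r, c2) \<in> D"
    by (rule down[OF active_D[OF assms(2)]]) (use D_pos[OF active_D[OF assms(1)]] assms in auto)
  have "R0 (r, c2) \<le> R0 (r, c1)" "R0 (r, c3) \<le> R0 (r, c2)"
    using assms D active_D by (auto intro!: row)
  then have "R0 (r, c2) \<in> {k, Suc k}"
    using active_value[OF assms(1)] active_value[OF assms(2)] by auto
  moreover have "(r, c2) \<notin> Z"
    using Z_row[of r c1 c2] assms(1,3) by (auto simp: active_def)
  ultimately show ?thesis
    using D by (simp add: active_def)
qed

definition free_cols where "free_cols r = {c. (r, c) \<in> free}"

lemma free_active: "b \<in> free \<Longrightarrow> b \<in> active"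
  by (simp add: free_def)

lemma finite_free_cols: "finite (free_cols r)"
proof (rule finite_subset)
  show "free_cols r \<subseteq> snd ` D"
    using free_active active_D by (force simp: free_cols_def)
qed (simp add: finite_boxes)

lemma free_cols_interval: "\<exists>p. free_cols r = {Suc p..p + card (free_cols r)}"
proof (rule convex_finite_set_eq_interval[OF finite_free_cols])
  show "0 \<notin> free_cols r"
    using D_pos[of r 0] active_D[of r 0] free_active by (force simp: free_cols_def)
  fix a b c
  assume abc: "a \<in> free_cols r" "c \<in> free_cols r" "a \<le> b" "b \<le> c"
  then have active: "(r, a) \<in> active" "(r, c) \<in> active"
    using free_active by (auto simp: free_cols_def)
  then have "(r, b) \<in> active"
    using row_between_active abc by blast
  then show "b \<in> free_cols r"
    using upper_left[of r b c] lower_right[of r b a] active abc by (auto simp: free_cols_def free_def)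
qed

definition offset where "offset r = (SOME p. free_cols r = {Suc p..p + card (free_cols r)})"

lemma free_cols_eq: "free_cols r = {Suc (offset r)..offset r + card (free_cols r)}"
  unfolding offset_def by (rule someI_ex[OF free_cols_interval])

text \<open>The tableaux that arise from \<open>R0\<close> by redistributing the two letters: in row \<open>r\<close> the \<open>t r\<close> rightmost
free boxes receive \<open>k + 1\<close> and the other free boxes receive \<open>k\<close>.\<close>

definition refill where
  "refill t b = (if b \<in> free then if snd b \<le> offset (fst b) + t (fst b) then Suc k else k else R0 b)"

lemma refill_row:
  assumes "(r, c) \<in> D" "(r, c') \<in> D" "c < c'"
  shows "refill t (r, c') \<le> refill t (r, c)"
proof -
  have le: "R0 (r, c') \<le> R0 (r, c)"
    using row assms by auto
  consider "(r, c) \<in> free" "(r, c') \<in> free" | "(r, c) \<notin> free" "(r, c') \<notin> free"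
    | "(r, c) \<in> free" "(r, c') \<notin> free" | "(r, c) \<notin> free" "(r, c') \<in> free" by blast
  then show ?thesis
  proof cases
    case 3
    then have active: "(r, c) \<in> active" by (simp add: free_active)
    have "R0 (r, c') \<noteq> Suc k"
    proof
      \<comment> \<open>The box above \<open>(r, c')\<close> would be active, hence also the one above \<open>(r, c)\<close>; but \<open>(r, c)\<close> is free.\<close>
      assume c': "R0 (r, c') = Suc k"
      have "(r, c') \<notin> Z"
        using Z_row[of r c c'] active assms(3) by (auto simp: active_def)
      then have active': "(r, c') \<in> active"
        using c' assms by (simp add: active_def)
      then have "(r, c') \<in> lower"
        using 3 c' upper_value[of r c'] by (auto simp: free_def)
      then show False
        using lower_right[of r c' c] active 3 assms by (auto simp: free_def)
    qed
    moreover have "R0 (r, c') \<le> Suc k"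
      using le active_value[OF active] by auto
    ultimately show ?thesis
      using 3 by (auto simp: refill_def)
  next
    case 4
    then have active: "(r, c') \<in> active" by (simp add: free_active)
    have "R0 (r, c) \<noteq> k"
    proof
      \<comment> \<open>Then \<open>(r, c')\<close> would have an active box below it, either by \<open>Z_row\<close> or because \<open>(r, c)\<close> has one.\<close>
      assume c: "R0 (r, c) = k"
      then have c': "R0 (r, c') = k"
        using le active_value[OF active] by auto
      show False
      proof (cases "(r, c) \<in> Z")
        case True
        then have "(r - 1, c') \<in> D" "R0 (r - 1, c') = Suc k"
          using Z_row[of r c' c] active c by (auto simp: active_def)
        moreover have "r - 1 < r"
          using D_pos[OF assms(1)] by simp
        ultimately have "(r, c') \<in> upper"
          using upperI[OF active] by auto
        then show False
          using 4 by (simp add: free_def)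
      next
        case False
        then have "(r, c) \<in> active"
          using c assms by (simp add: active_def)
        then have "(r, c) \<in> upper"
          using 4 c lower_value[of r c] by (auto simp: free_def)
        then show False
          using upper_left[of r c c'] active 4 assms by (auto simp: free_def)
      qed
    qed
    moreover have "k \<le> R0 (r, c)"
      using le active_value[OF active] by auto
    ultimately show ?thesis
      using 4 by (auto simp: refill_def)
  qed (use assms le in \<open>auto simp: refill_def\<close>)
qed

lemma refill_column:
  assumes "(r, c) \<in> D" "(r', c) \<in> D" "r < r'"
  shows "refill t (r', c) < refill t (r, c)"
proof -
  have less: "R0 (r', c) < R0 (r, c)"
    using column assms by auto
  show ?thesis
  proof (cases "(r, c) \<in> free")
    case True
    then have active: "(r, c) \<in> active" by (simp add: free_active)
    then have "\<not> k \<le> R0 (r', c)"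
      using lowerI[OF active assms(2,3)] True by (auto simp: free_def)
    then have "R0 (r', c) < k" by simp
    moreover from this have "(r', c) \<notin> free"
      using free_active active_value[of r' c] by auto
    ultimately show ?thesis
      using True by (auto simp: refill_def)
  next
    case False
    show ?thesis
    proof (cases "(r', c) \<in> free")
      case True
      then have active: "(r', c) \<in> active" by (simp add: free_active)
      then have "\<not> R0 (r, c) \<le> Suc k"
        using upperI[OF active assms(1,3)] True by (auto simp: free_def)
      then have "Suc k < R0 (r, c)" by simp
      then show ?thesis
        using True False by (auto simp: refill_def)
    qed (use False less in \<open>auto simp: refill_def\<close>)
  qed
qed

lemma free_D: "free \<subseteq> D"
  using free_active by (auto simp: active_def)

lemma free_Z: "free \<inter> Z = {}"
  using free_active by (auto simp: active_def)

lemma refill_tableau: "refill t \<in> reverse_tableaux d \<mu>"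
proof -
  have "R0 \<in> D \<rightarrow>\<^sub>E {1..d}"
    using tableau by (simp add: reverse_tableaux_def)
  then have "refill t \<in> D \<rightarrow>\<^sub>E {1..d}"
    using k free_D by (fastforce simp: refill_def PiE_iff extensional_def)
  then show ?thesis
    using refill_row refill_column by (auto simp: reverse_tableaux_def increasing_reverse_def)
qed

text \<open>Forgets the difference between the two letters outside \<open>Z\<close>; the tableaux with the same image as \<open>R0\<close>
are the redistributions of \<open>R0\<close>.\<close>

definition collapse where
  "collapse R b = (if b \<notin> Z \<and> R b = Suc k then k else R b)" for R :: "box \<Rightarrow> nat"

definition fibre where
  "fibre = {R \<in> reverse_tableaux d \<mu>. (\<forall>b\<in>Z. R b = R0 b) \<and> collapse R = collapse R0}"

lemma refill_in_fibre: "refill t \<in> fibre"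
proof -
  have "collapse (refill t) b = collapse R0 b" for b
    using active_value[of "fst b" "snd b"] free_active[of b] free_Z by (auto simp: collapse_def refill_def)
  moreover have "refill t b = R0 b" if "b \<in> Z" for b
    using free_Z that by (auto simp: refill_def)
  ultimately show ?thesis
    using refill_tableau by (auto simp: fibre_def)
qed

lemma fibre_value:
  assumes "R \<in> fibre" "b \<notin> free"
  shows "R b = R0 b"
proof -
  obtain r c where b: "b = (r, c)" by fastforce
  have R: "R \<in> reverse_tableaux d \<mu>" and col: "collapse R b = collapse R0 b" for b
    using assms by (auto simp: fibre_def)
  have activeR: "R b \<in> {k, Suc k}" if "b \<in> active" for b
    using col[of b] that by (auto simp: active_def collapse_def split: if_splits)
  show ?thesis
  proof (cases "b \<in> active")
    case True
    then have "b \<in> upper \<or> b \<in> lower"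
      using assms by (auto simp: free_def)
    then show ?thesis
    proof
      assume t: "b \<in> upper"
      then have "(r, c) \<in> active" "(r - 1, c) \<in> active" "1 \<le> r"
        by (auto simp: upper_def b)
      then have "R (r, c) < R (r - 1, c)" "R (r - 1, c) \<in> {k, Suc k}" "R (r, c) \<in> {k, Suc k}"
        using activeR by (auto intro!: reverse_tableau_column[OF R] active_D)
      then show ?thesis
        using t upper_value[of r c] by (auto simp: b)
    next
      assume t: "b \<in> lower"
      then have "(r, c) \<in> active" "(Suc r, c) \<in> active"
        by (auto simp: lower_def b)
      then have "R (Suc r, c) < R (r, c)" "R (Suc r, c) \<in> {k, Suc k}" "R (r, c) \<in> {k, Suc k}"
        using activeR by (auto intro!: reverse_tableau_column[OF R] active_D)
      then show ?thesis
        using t lower_value[of r c] by (auto simp: b)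
    qed
  next
    case False
    show ?thesis
    proof (cases "b \<in> D")
      case True
      show ?thesis
      proof (cases "b \<in> Z")
        case True
        then show ?thesis
          using assms(1) by (simp add: fibre_def)
      next
        case nZ: False
        then have "R0 b \<noteq> k" "R0 b \<noteq> Suc k"
          using False True by (auto simp: active_def)
        then show ?thesis
          using nZ col[of b] by (simp add: collapse_def split: if_splits)
      qed
    next
      case False
      then show ?thesis
        using R tableau by (simp add: reverse_tableaux_def PiE_iff extensional_def b)
    qed
  qed
qed

lemma fibre_eq: "fibre = refill ` (\<Pi>\<^sub>E r\<in>{1..d}. {..card (free_cols r)})"
proof (intro set_eqI iffI)
  fix R assume R: "R \<in> fibre"
  then have tab: "R \<in> reverse_tableaux d \<mu>"
    by (simp add: fibre_def)
  define T where "T r = {c \<in> free_cols r. R (r, c) = Suc k}" for r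
  define t where "t = (\<lambda>r\<in>{1..d}. card (T r))"
  have T_sub: "T r \<subseteq> free_cols r" for r
    by (auto simp: T_def)
  then have t: "t \<in> (\<Pi>\<^sub>E r\<in>{1..d}. {..card (free_cols r)})"
    by (auto simp: t_def intro!: card_mono finite_free_cols)
  have two: "R (r, c) \<in> {k, Suc k}" if "c \<in> free_cols r" for r c
  proof -
    have "(r, c) \<in> active"
      using that free_active by (simp add: free_cols_def)
    moreover have "collapse R (r, c) = collapse R0 (r, c)"
      using R by (simp add: fibre_def)
    ultimately show ?thesis
      by (auto simp: active_def collapse_def split: if_splits)
  qed
  have T_down: "c' \<in> T r" if "c \<in> T r" "c' \<in> free_cols r" "c' \<le> c" for r c c'
  proof -
    have "R (r, c) \<le> R (r, c')"
      by (rule reverse_tableau_row[OF tab]) (use that T_sub free_D in \<open>auto simp: free_cols_def\<close>)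
    then show ?thesis
      using that two[of c' r] by (auto simp: T_def)
  qed
  have T_eq: "T r = {Suc (offset r)..offset r + card (T r)}" for r
  proof (cases "T r = {}")
    case False
    have fin: "finite (T r)"
      using T_sub finite_free_cols finite_subset by blast
    have M: "Max (T r) \<in> T r"
      using fin False by simp
    have T_int: "c \<in> {Suc (offset r)..offset r + card (free_cols r)}" if "c \<in> T r" for c
      using that T_sub[of r] free_cols_eq[of r] by blast
    have 1: "Suc (offset r) \<le> Max (T r)" "Max (T r) \<le> offset r + card (free_cols r)"
      using T_int[OF M] by auto
    have "T r = {Suc (offset r)..Max (T r)}"
    proof (intro set_eqI iffI)
      fix c assume "c \<in> T r"
      then show "c \<in> {Suc (offset r)..Max (T r)}"
        using fin T_int[of c] by simp
    next
      fix c assume c: "c \<in> {Suc (offset r)..Max (T r)}"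
      then have "c \<in> free_cols r"
        using 1 by (subst free_cols_eq) simp
      then show "c \<in> T r"
        using T_down[OF M] c by simp
    qed
    note iv = this
    have "offset r + card (T r) = Max (T r)"
      using arg_cong[OF iv, of card] 1(1) by simp
    then show ?thesis
      by (intro trans[OF iv]) simp
  qed simp
  have "R b = refill t b" for b
  proof (cases "b \<in> free")
    case True
    obtain r c where b: "b = (r, c)" by fastforce
    have c: "c \<in> free_cols r"
      using True by (simp add: free_cols_def b)
    have "r \<in> {1..d}"
      using True free_D by (auto simp: b boxes_def)
    then have "t r = card (T r)"
      by (simp add: t_def)
    moreover have "Suc (offset r) \<le> c"
      using c by (subst (asm) free_cols_eq) simp
    moreover have "c \<in> T r \<longleftrightarrow> c \<in> {Suc (offset r)..offset r + card (T r)}"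
      using T_eq[of r] by simp
    ultimately have "c \<in> T r \<longleftrightarrow> c \<le> offset r + t r"
      by simp
    then show ?thesis
      using True c two[OF c] by (auto simp: refill_def b T_def)
  qed (use fibre_value[OF R] in \<open>simp add: refill_def\<close>)
  then have "R = refill t" by (rule ext)
  then show "R \<in> refill ` (\<Pi>\<^sub>E r\<in>{1..d}. {..card (free_cols r)})"
    using t by blast
qed (use refill_in_fibre in blast)

lemma refill_inj: "inj_on refill (\<Pi>\<^sub>E r\<in>{1..d}. {..card (free_cols r)})"
proof (rule inj_onI)
  fix t u
  assume t: "t \<in> (\<Pi>\<^sub>E r\<in>{1..d}. {..card (free_cols r)})" and u: "u \<in> (\<Pi>\<^sub>E r\<in>{1..d}. {..card (free_cols r)})"
    and eq: "refill t = refill u"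
  have less: False if "r \<in> {1..d}" "f r < g r" "g r \<le> card (free_cols r)" "refill f = refill g" for r f g
  proof -
    have "offset r + g r \<in> free_cols r"
      using that by (subst free_cols_eq) auto
    then have "(r, offset r + g r) \<in> free"
      by (simp add: free_cols_def)
    then show False
      using fun_cong[OF that(4), of "(r, offset r + g r)"] that(2) by (simp add: refill_def)
  qed
  show "t = u"
  proof (rule PiE_ext[OF t u])
    fix r assume "r \<in> {1..d}"
    then show "t r = u r"
      using less[of r t u] less[of r u t] PiE_mem[OF t, of r] PiE_mem[OF u, of r] eq
      by (cases "t r" "u r" rule: linorder_cases) auto
  qed
qed

abbreviation (input) factor :: "(nat \<Rightarrow> 'a::comm_ring_1) \<Rightarrow> (nat \<Rightarrow> 'a) \<Rightarrow> box \<Rightarrow> nat \<Rightarrow> 'a" where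
  "factor y x b a \<equiv> x a - y (yindex d a b)"

definition row_sum :: "(nat \<Rightarrow> 'a::comm_ring_1) \<Rightarrow> (nat \<Rightarrow> 'a) \<Rightarrow> nat \<Rightarrow> 'a" where
  "row_sum y x r = (\<Sum>t\<le>card (free_cols r).
     (\<Prod>i<t. x (Suc k) - y (d - k + offset r + 1 + i - r)) *
     (\<Prod>i\<in>{t..<card (free_cols r)}. x k - y (d - k + offset r + 1 + Suc i - r)))"

lemma free_Sigma: "free = Sigma {1..d} free_cols"
  using free_D by (auto simp: free_cols_def boxes_def)

lemma row_product:
  assumes "t \<le> card (free_cols r)"
  shows "(\<Prod>c\<in>free_cols r. factor y x (r, c) (if c \<le> offset r + t then Suc k else k)) =
     (\<Prod>i<t. x (Suc k) - y (d - k + offset r + 1 + i - r)) *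
     (\<Prod>i\<in>{t..<card (free_cols r)}. x k - y (d - k + offset r + 1 + Suc i - r))"
proof -
  let ?f = "\<lambda>c. factor y x (r, c) (if c \<le> offset r + t then Suc k else k)"
  have "bij_betw (\<lambda>i. offset r + 1 + i) {..<card (free_cols r)} {Suc (offset r)..offset r + card (free_cols r)}"
    by (rule bij_betw_byWitness[where f' = "\<lambda>c. c - Suc (offset r)"]) auto
  then have "bij_betw (\<lambda>i. offset r + 1 + i) {..<card (free_cols r)} (free_cols r)"
    using free_cols_eq[of r] by simp
  then have "prod ?f (free_cols r) = (\<Prod>i<card (free_cols r). ?f (offset r + 1 + i))"
    by (rule prod.reindex_bij_betw[symmetric])
  also have "{..<card (free_cols r)} = {..<t} \<union> {t..<card (free_cols r)}"
    using assms by auto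
  also have "(\<Prod>i\<in>\<dots>. ?f (offset r + 1 + i)) =
      (\<Prod>i<t. ?f (offset r + 1 + i)) * (\<Prod>i\<in>{t..<card (free_cols r)}. ?f (offset r + 1 + i))"
    by (rule prod.union_disjoint) auto
  also have "(\<Prod>i<t. ?f (offset r + 1 + i)) = (\<Prod>i<t. x (Suc k) - y (d - k + offset r + 1 + i - r))"
    by (rule prod.cong) (auto simp: yindex_def add_ac)
  also have "(\<Prod>i\<in>{t..<card (free_cols r)}. ?f (offset r + 1 + i)) =
      (\<Prod>i\<in>{t..<card (free_cols r)}. x k - y (d - k + offset r + 1 + Suc i - r))"
    using k by (intro prod.cong) (auto simp: yindex_def Suc_diff_le add_ac)
  finally show ?thesis .
qed

text \<open>The free boxes of different rows do not interact, so the sum over the fibre is a product over rows.\<close>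

lemma fibre_sum:
  "(\<Sum>R\<in>fibre. \<Prod>b\<in>D - Z. factor y x b (R b)) =
     (\<Prod>b\<in>D - Z - free. factor y x b (R0 b)) * (\<Prod>r\<in>{1..d}. row_sum y x r)"
proof -
  let ?T = "\<Pi>\<^sub>E r\<in>{1..d}. {..card (free_cols r)}"
  let ?C = "\<Prod>b\<in>D - Z - free. factor y x b (R0 b)"
  have prod: "(\<Prod>b\<in>D - Z. factor y x b (refill t b)) =
      ?C * (\<Prod>r\<in>{1..d}. \<Prod>c\<in>free_cols r. factor y x (r, c) (if c \<le> offset r + t r then Suc k else k))" for t
  proof -
    have "(\<Prod>b\<in>D - Z. factor y x b (refill t b)) =
        (\<Prod>b\<in>D - Z - free. factor y x b (refill t b)) * (\<Prod>b\<in>free. factor y x b (refill t b))"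
      by (rule prod.subset_diff) (use free_D free_Z finite_boxes in auto)
    also have "(\<Prod>b\<in>D - Z - free. factor y x b (refill t b)) = ?C"
      by (rule prod.cong) (auto simp: refill_def)
    also have "(\<Prod>b\<in>free. factor y x b (refill t b)) =
        (\<Prod>(r, c)\<in>Sigma {1..d} free_cols. factor y x (r, c) (refill t (r, c)))"
      unfolding free_Sigma by (rule prod.cong) auto
    also have "\<dots> = (\<Prod>r\<in>{1..d}. \<Prod>c\<in>free_cols r. factor y x (r, c) (refill t (r, c)))"
      by (rule prod.Sigma[symmetric]) (auto simp: finite_free_cols)
    also have "\<dots> = (\<Prod>r\<in>{1..d}. \<Prod>c\<in>free_cols r. factor y x (r, c) (if c \<le> offset r + t r then Suc k else k))"
      by (intro prod.cong refl) (simp add: refill_def free_cols_def)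
    finally show ?thesis .
  qed
  have "(\<Sum>R\<in>fibre. \<Prod>b\<in>D - Z. factor y x b (R b)) =
      (\<Sum>t\<in>?T. \<Prod>b\<in>D - Z. factor y x b (refill t b))"
    unfolding fibre_eq by (rule sum.reindex_cong[OF refill_inj refl refl])
  also have "\<dots> = ?C * (\<Sum>t\<in>?T. \<Prod>r\<in>{1..d}. \<Prod>c\<in>free_cols r.
      factor y x (r, c) (if c \<le> offset r + t r then Suc k else k))"
    unfolding prod sum_distrib_left ..
  also have "(\<Sum>t\<in>?T. \<Prod>r\<in>{1..d}. \<Prod>c\<in>free_cols r. factor y x (r, c) (if c \<le> offset r + t r then Suc k else k)) =
      (\<Prod>r\<in>{1..d}. \<Sum>t\<le>card (free_cols r). \<Prod>c\<in>free_cols r. factor y x (r, c) (if c \<le> offset r + t then Suc k else k))"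
    by (rule prod_sum_PiE[symmetric]) auto
  also have "\<dots> = (\<Prod>r\<in>{1..d}. row_sum y x r)"
    unfolding row_sum_def by (intro prod.cong sum.cong refl row_product) auto
  finally show ?thesis .
qed

text \<open>The two boxes of a vertical pair have the same index of \<open>y\<close>: passing from \<open>k\<close> in row \<open>r + 1\<close> to
\<open>k + 1\<close> in row \<open>r\<close> lowers \<open>a'\<close> and \<open>r\<close> by one each. This makes the forced part symmetric.\<close>

lemma forced_product:
  "(\<Prod>b\<in>D - Z - free. factor y x b (R0 b)) =
     (\<Prod>b\<in>D - Z - active. factor y x b (R0 b)) *
     (\<Prod>(r, c)\<in>lower. (x k - y (d - k + c - r)) * (x (Suc k) - y (d - k + c - r)))"
proof -
  have fin: "finite active" "finite upper" "finite lower"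
    by (rule finite_subset[OF _ finite_boxes[of d \<mu>]]; auto simp: active_def upper_def lower_def)+
  have disj: "upper \<inter> lower = {}"
    using upper_value lower_value by fastforce
  have tb: "upper \<subseteq> active" "lower \<subseteq> active"
    by (auto simp: upper_def lower_def)
  have active: "active \<subseteq> D - Z"
    by (auto simp: active_def)
  have "D - Z - free = (D - Z - active) \<union> (upper \<union> lower)"
    unfolding free_def using tb active by blast
  moreover have "(D - Z - active) \<inter> (upper \<union> lower) = {}"
    using tb by blast
  ultimately have "(\<Prod>b\<in>D - Z - free. factor y x b (R0 b)) =
      (\<Prod>b\<in>D - Z - active. factor y x b (R0 b)) * (\<Prod>b\<in>upper \<union> lower. factor y x b (R0 b))"
    using fin finite_boxes[of d \<mu>] by (simp only: prod.union_disjoint finite_Diff finite_Un)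
  also have "(\<Prod>b\<in>upper \<union> lower. factor y x b (R0 b)) =
      (\<Prod>b\<in>upper. factor y x b (R0 b)) * (\<Prod>b\<in>lower. factor y x b (R0 b))"
    by (rule prod.union_disjoint) (use fin disj in auto)
  also have "(\<Prod>b\<in>upper. factor y x b (R0 b)) = (\<Prod>(r, c)\<in>lower. x k - y (d - k + c - r))"
  proof -
    have "bij_betw (\<lambda>(r, c). (Suc r, c)) lower upper"
      by (rule bij_betw_byWitness[where f' = "\<lambda>(r, c). (r - 1, c)"])
        (auto simp: upper_def lower_def Suc_diff_Suc Suc_le_eq)
    then have "(\<Prod>b\<in>upper. factor y x b (R0 b)) =
        (\<Prod>b\<in>lower. factor y x ((\<lambda>(r, c). (Suc r, c)) b) (R0 ((\<lambda>(r, c). (Suc r, c)) b)))"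
      by (rule prod.reindex_bij_betw[symmetric])
    also have "\<dots> = (\<Prod>(r, c)\<in>lower. x k - y (d - k + c - r))"
    proof (rule prod.cong[OF refl], clarify)
      fix r c assume "(r, c) \<in> lower"
      then have "(Suc r, c) \<in> upper"
        by (auto simp: upper_def lower_def)
      then show "factor y x (Suc r, c) (R0 (Suc r, c)) = x k - y (d - k + c - r)"
        using k by (simp add: upper_value yindex_def Suc_diff_le)
    qed
    finally show ?thesis .
  qed
  also have "(\<Prod>b\<in>lower. factor y x b (R0 b)) = (\<Prod>(r, c)\<in>lower. x (Suc k) - y (d - k + c - r))"
    by (rule prod.cong) (auto simp: lower_value yindex_def)
  also have "(\<Prod>(r, c)\<in>lower. x k - y (d - k + c - r)) * (\<Prod>(r, c)\<in>lower. x (Suc k) - y (d - k + c - r)) =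
      (\<Prod>(r, c)\<in>lower. (x k - y (d - k + c - r)) * (x (Suc k) - y (d - k + c - r)))"
    by (simp add: prod.distrib case_prod_unfold)
  finally show ?thesis .
qed

lemma fibre_sum_symmetric:
  fixes x y :: "nat \<Rightarrow> 'a::idom"
  shows "(\<Sum>R\<in>fibre. \<Prod>b\<in>D - Z. factor y (x \<circ> transpose k (Suc k)) b (R b)) =
           (\<Sum>R\<in>fibre. \<Prod>b\<in>D - Z. factor y x b (R b))"
proof -
  let ?x = "x \<circ> transpose k (Suc k)"
  have rs: "row_sum y ?x r = row_sum y x r" for r
    using two_letter_row_symmetric[where u = "x (Suc k)" and v = "x k" and m = "card (free_cols r)"
        and z = "\<lambda>i. y (d - k + offset r + 1 + i - r)"]
    by (simp add: row_sum_def)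
  have "(\<Prod>r\<in>{1..d}. row_sum y ?x r) = (\<Prod>r\<in>{1..d}. row_sum y x r)"
    by (simp add: rs)
  moreover have "(\<Prod>b\<in>D - Z - active. factor y ?x b (R0 b)) = (\<Prod>b\<in>D - Z - active. factor y x b (R0 b))"
    by (rule prod.cong) (auto simp: active_def transpose_def)
  moreover have "(\<Prod>(r, c)\<in>lower. (?x k - y (d - k + c - r)) * (?x (Suc k) - y (d - k + c - r))) =
      (\<Prod>(r, c)\<in>lower. (x k - y (d - k + c - r)) * (x (Suc k) - y (d - k + c - r)))"
    by (rule prod.cong) (auto simp: mult.commute)
  ultimately show ?thesis
    unfolding fibre_sum forced_product by (simp only:)
qed

end

text \<open>The tableaux that extend a given filling \<open>V\<close> of the boxes \<open>Z\<close>, and the sum of their weights over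
the remaining boxes.\<close>

definition completions ::
    "nat \<Rightarrow> (nat \<Rightarrow> nat) \<Rightarrow> box set \<Rightarrow> (box \<Rightarrow> nat) \<Rightarrow> (box \<Rightarrow> nat) set" where
  "completions d \<mu> Z V = {R \<in> reverse_tableaux d \<mu>. \<forall>b\<in>Z. R b = V b}"

definition completion_sum ::
    "nat \<Rightarrow> (nat \<Rightarrow> nat) \<Rightarrow> (nat \<Rightarrow> 'a::comm_ring_1) \<Rightarrow> box set \<Rightarrow> (box \<Rightarrow> nat) \<Rightarrow> (nat \<Rightarrow> 'a) \<Rightarrow> 'a" where
  "completion_sum d \<mu> y Z V x =
     (\<Sum>R\<in>completions d \<mu> Z V. \<Prod>b\<in>boxes d \<mu> - Z. x (R b) - y (yindex d (R b) b))"

text \<open>Each fibre of \<open>collapse\<close> contributes a symmetric sum.\<close>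

lemma completion_sum_symmetric:
  fixes x y :: "nat \<Rightarrow> 'a::idom"
  assumes "\<And>R. R \<in> completions d \<mu> Z V \<Longrightarrow> two_letters d \<mu> k Z R"
  shows "completion_sum d \<mu> y Z V (x \<circ> transpose k (Suc k)) = completion_sum d \<mu> y Z V x"
proof -
  let ?E = "completions d \<mu> Z V"
  let ?f = "\<lambda>x. \<lambda>R. \<Prod>b\<in>boxes d \<mu> - Z. x (R b) - y (yindex d (R b) b)"
  have fin: "finite ?E"
    unfolding completions_def using finite_reverse_tableaux by simp
  have "sum (?f (x \<circ> transpose k (Suc k))) {R \<in> ?E. two_letters.collapse k Z R = Q} =
        sum (?f x) {R \<in> ?E. two_letters.collapse k Z R = Q}"
    if Q: "Q \<in> two_letters.collapse k Z ` ?E" for Q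
  proof -
    obtain R0 where R0: "R0 \<in> ?E" "Q = two_letters.collapse k Z R0"
      using Q by blast
    interpret two_letters d \<mu> k Z R0
      by (rule assms[OF R0(1)])
    have "{R \<in> ?E. collapse R = Q} = fibre"
      using R0 by (auto simp: fibre_def completions_def)
    then show ?thesis
      using fibre_sum_symmetric[of x y] by simp
  qed
  then show ?thesis
    unfolding completion_sum_def
    by (subst (1 2) sum.image_gen[OF fin, of _ "two_letters.collapse k Z"]) (rule sum.cong[OF refl])
qed

section \<open>Expanding a product box by box\<close>

lemma sorted_wrt_concat:
  assumes "\<And>xs. xs \<in> set xss \<Longrightarrow> sorted_wrt P xs"
    and "sorted_wrt (\<lambda>xs ys. \<forall>x\<in>set xs. \<forall>y\<in>set ys. P x y) xss"
  shows "sorted_wrt P (concat xss)"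
  using assms by (induction xss) (auto simp: sorted_wrt_append)

lemma distinct_if_sorted_wrt_irrefl:
  assumes "sorted_wrt P xs" "\<And>x. \<not> P x x"
  shows "distinct xs"
  using assms(1) by (induction xs) (auto simp: assms(2))

definition before_reverse :: "box \<Rightarrow> box \<Rightarrow> bool" where
  "before_reverse = (\<lambda>(r, c) (r', c'). c < c' \<or> c = c' \<and> r' < r)"

lemma sorted_reading_reverse: "sorted_wrt before_reverse (reading_reverse d \<mu>)"
proof -
  have inner: "sorted_wrt before_reverse (concat (map (\<lambda>r. if c \<le> \<mu> r then [(r, c)] else []) (rev [1..<d + 1])))" for c
    by (rule sorted_wrt_concat)
      (auto simp: sorted_wrt_map sorted_wrt_rev before_reverse_def simp del: upt_Suc
        intro!: sorted_wrt_mono_rel[OF _ sorted_wrt_upt] split: if_splits)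
  show ?thesis
    unfolding reading_reverse_def
    by (rule sorted_wrt_concat)
      (use inner in \<open>auto simp: sorted_wrt_map before_reverse_def simp del: upt_Suc
        intro!: sorted_wrt_mono_rel[OF _ sorted_wrt_upt] split: if_splits\<close>)
qed

lemma distinct_reading_reverse: "distinct (reading_reverse d \<mu>)"
  by (rule distinct_if_sorted_wrt_irrefl[OF sorted_reading_reverse]) (auto simp: before_reverse_def)

lemma le_first_part:
  assumes "\<mu> \<in> partitions d" "r \<in> {1..d}"
  shows "\<mu> r \<le> \<mu> 1"
  using assms by (auto simp: partitions_def)

lemma set_reading_reverse:
  assumes "\<mu> \<in> partitions d"
  shows "set (reading_reverse d \<mu>) = boxes d \<mu>"
  using le_first_part[OF assms]
  by (fastforce simp: reading_reverse_def boxes_def less_Suc_eq_le simp del: upt_Suc split: if_splits)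

lemma reading_reverse_split:
  assumes \<mu>: "\<mu> \<in> partitions d" and eq: "reading_reverse d \<mu> = ps @ (r, c) # rs"
  shows "set ps = {(r', c') \<in> boxes d \<mu>. c' < c \<or> c' = c \<and> r < r'}"
proof -
  have all: "boxes d \<mu> = set ps \<union> {(r, c)} \<union> set rs"
    using set_reading_reverse[OF \<mu>] eq by auto
  have "before_reverse b (r, c)" if "b \<in> set ps" for b
    using sorted_reading_reverse[of d \<mu>] that unfolding eq by (auto simp: sorted_wrt_append)
  moreover have "before_reverse (r, c) b" if "b \<in> set rs" for b
    using sorted_reading_reverse[of d \<mu>] that unfolding eq by (auto simp: sorted_wrt_append)
  ultimately show ?thesis
    unfolding all by (fastforce simp: before_reverse_def)
qed

text \<open>Why the sum over completions is symmetric right after \<open>k + 1\<close> has been read in the box \<open>(r0, j)\<close>. The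
boxes read are those of columns \<open>1, \<dots>, j - 1\<close> and those of column \<open>j\<close> from row \<open>r0\<close> upwards. The rest
of column \<open>j\<close> lies below a \<open>k + 1\<close> and has larger values, so active boxes have columns beyond \<open>j\<close>.
In rows up to \<open>r0\<close> the value in column \<open>j\<close> is at least \<open>k + 1\<close>. In a row above \<open>r0\<close>, an active box
lies in a column whose entry in row \<open>r0\<close> is at most \<open>k + 1\<close>; by strictness it carries \<open>k\<close> and has
\<open>k + 1\<close> directly below.\<close>

lemma two_letters_after_box:
  assumes \<mu>: "\<mu> \<in> partitions d" and bD: "(r0, j) \<in> boxes d \<mu>"
    and k: "1 \<le> k" "Suc k \<le> d"
    and tab: "R \<in> reverse_tableaux d \<mu>" and Rb: "R (r0, j) = Suc k"
    and Z: "\<And>r c. (r, c) \<in> Z \<longleftrightarrow> (r, c) \<in> boxes d \<mu> \<and> (c < j \<or> c = j \<and> r0 \<le> r)"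
  shows "two_letters d \<mu> k Z R"
proof -
  let ?D = "boxes d \<mu>"
  note row = reverse_tableau_row[OF tab] and column = reverse_tableau_column[OF tab]
  note down = boxes_downward_closed[OF \<mu>]
  have pos: "1 \<le> j" "1 \<le> r0"
    using bD by (auto simp: boxes_def)
  have right: "j < c" if "(r, c) \<in> ?D - Z" "R (r, c) \<in> {k, Suc k}" for r c
  proof (rule ccontr)
    assume "\<not> j < c"
    then have "c = j" "r < r0"
      using that(1) Z[of r c] by auto
    then show False
      using column[of r j r0] that bD Rb by auto
  qed
  show ?thesis
  proof unfold_locales
    fix r r' c assume "(r, c) \<in> ?D - Z" "R (r, c) \<in> {k, Suc k}"
    then have "j < c" by (rule right)
    then show "(r', c) \<notin> Z"
      using Z[of r' c] by simp
  next
    fix r c c'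
    assume rc: "(r, c) \<in> ?D - Z" "R (r, c) \<in> {k, Suc k}" and c': "(r, c') \<in> Z"
    have c: "j < c" "c' \<le> j" "(r, c') \<in> ?D" "(r, c) \<in> ?D"
      using right[OF rc] c' Z[of r c'] rc(1) by auto
    have rpos: "1 \<le> r"
      using c(3) by (simp add: boxes_def)
    have rj: "(r, j) \<in> ?D"
      by (rule down[OF c(4)]) (use c pos rpos in simp_all)
    have le: "R (r, j) \<le> R (r, c')"
      by (rule row[OF c(3) rj c(2)])
    have "Suc k \<le> R (r, c') \<or> (r - 1, c) \<in> ?D \<and> R (r - 1, c) = Suc k"
    proof (cases "r \<le> r0")
      case True
      then have "Suc k \<le> R (r, j)"
        using column[OF rj bD] Rb by (cases "r = r0") simp_all
      then show ?thesis
        using le by simp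
    next
      case False
      have D1: "(r0, c) \<in> ?D"
        by (rule down[OF c(4)]) (use False pos c in simp_all)
      have D2: "(r - 1, c) \<in> ?D"
        by (rule down[OF c(4)]) (use False pos c in simp_all)
      have "R (r0, c) \<le> Suc k"
        using row[OF bD D1] c(1) Rb by simp
      moreover have "r0 < r - 1 \<or> r0 = r - 1"
        using False by linarith
      then have "R (r - 1, c) \<le> R (r0, c)"
        using column[OF D1 D2] by auto
      moreover have "R (r, c) < R (r - 1, c)"
        by (rule column[OF D2 c(4)]) (use rpos in simp)
      moreover have "k \<le> R (r, c)"
        using rc(2) by auto
      ultimately have "R (r - 1, c) = Suc k" by linarith
      then show ?thesis
        using D2 by simp
    qed
    then show "c' < c \<and> (Suc k \<le> R (r, c') \<or> (r - 1, c) \<in> ?D \<and> R (r - 1, c) = Suc k)"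
      using c by simp
  qed (use \<mu> k tab in auto)
qed

lemma completions_two_letters:
  assumes \<mu>: "\<mu> \<in> partitions d" and eq: "reading_reverse d \<mu> = ps @ b # rs"
    and k: "1 \<le> k" "Suc k \<le> d" and V: "V b = Suc k"
    and R: "R \<in> completions d \<mu> (insert b (set ps)) V"
  shows "two_letters d \<mu> k (insert b (set ps)) R"
proof -
  obtain r0 j where b: "b = (r0, j)" by fastforce
  have bD: "(r0, j) \<in> boxes d \<mu>"
    using set_reading_reverse[OF \<mu>] eq b by auto
  show ?thesis
  proof (rule two_letters_after_box[OF \<mu> bD k])
    fix r c
    show "(r, c) \<in> insert b (set ps) \<longleftrightarrow> (r, c) \<in> boxes d \<mu> \<and> (c < j \<or> c = j \<and> r0 \<le> r)"
      unfolding reading_reverse_split[OF \<mu> eq[unfolded b]] using bD b by auto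
  qed (use R V b in \<open>auto simp: completions_def\<close>)
qed

text \<open>The factorial Schur function evaluated at elements \<open>x\<close> and \<open>y\<close> of any commutative ring, so that
permuting the variables is just a composition.\<close>

definition schur :: "nat \<Rightarrow> (nat \<Rightarrow> nat) \<Rightarrow> (nat \<Rightarrow> 'a::comm_ring_1) \<Rightarrow> (nat \<Rightarrow> 'a) \<Rightarrow> 'a" where
  "schur d \<mu> y x = (\<Sum>R\<in>reverse_tableaux d \<mu>. \<Prod>b\<in>boxes d \<mu>. x (R b) - y (yindex d (R b) b))"

lemma schur_eq_completion_sum: "schur d \<mu> y = completion_sum d \<mu> y {} V"
  by (rule ext) (simp add: schur_def completion_sum_def completions_def)

text \<open>The case \<open>Z = {}\<close> of the symmetry of completion sums.\<close>

lemma schur_symmetric: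
  fixes x y :: "nat \<Rightarrow> 'a::idom"
  assumes \<mu>: "\<mu> \<in> partitions d" and w: "w permutes {1..d}"
  shows "schur d \<mu> y (x \<circ> w) = schur d \<mu> y x"
proof (rule symmetric_if_adjacent[OF _ w])
  fix k z assume k: "k \<in> {1..d}" "Suc k \<in> {1..d}"
  show "schur d \<mu> y (z \<circ> transpose k (Suc k)) = schur d \<mu> y z"
    unfolding schur_eq_completion_sum[of d \<mu> y undefined]
    by (rule completion_sum_symmetric, unfold_locales)
      (use \<mu> k in \<open>auto simp: completions_def\<close>)
qed

lemma completion_sum_split:
  assumes b: "b \<in> boxes d \<mu> - Z"
  shows "completion_sum d \<mu> y Z V z =
     (\<Sum>a\<in>{1..d}. (z a - y (yindex d a b)) * completion_sum d \<mu> y (insert b Z) (V(b := a)) z)"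
proof -
  let ?f = "\<lambda>R Z. \<Prod>b\<in>boxes d \<mu> - Z. z (R b) - y (yindex d (R b) b)"
  have fin: "finite (completions d \<mu> Z V)"
    unfolding completions_def using finite_reverse_tableaux by simp
  have fibre: "{R \<in> completions d \<mu> Z V. R b = a} = completions d \<mu> (insert b Z) (V(b := a))" for a
    using b by (auto simp: completions_def)
  have "completion_sum d \<mu> y Z V z =
      (\<Sum>a\<in>{1..d}. \<Sum>R\<in>{R \<in> completions d \<mu> Z V. R b = a}. ?f R Z)"
    unfolding completion_sum_def
    by (rule sum.group[symmetric, OF fin]) (use b in \<open>auto simp: completions_def reverse_tableaux_def\<close>)
  also have "\<dots> = (\<Sum>a\<in>{1..d}. (z a - y (yindex d a b)) *
      completion_sum d \<mu> y (insert b Z) (V(b := a)) z)"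
    unfolding fibre completion_sum_def sum_distrib_left
  proof (intro sum.cong refl)
    fix a R assume "R \<in> completions d \<mu> (insert b Z) (V(b := a))"
    then have "R b = a"
      by (simp add: completions_def)
    moreover have "boxes d \<mu> - insert b Z = boxes d \<mu> - Z - {b}" by blast
    then have "?f R Z = (z (R b) - y (yindex d (R b) b)) * ?f R (insert b Z)"
      using prod.remove[OF _ b, of "\<lambda>b. z (R b) - y (yindex d (R b) b)"] finite_boxes[of d \<mu>] by simp
    ultimately show "?f R Z = (z a - y (yindex d a b)) * ?f R (insert b Z)"
      by simp
  qed
  finally show ?thesis .
qed

abbreviation entries :: "nat \<Rightarrow> entry set" where
  "entries d \<equiv> Unbarred ` {1..d} \<union> Barred ` {1..d}"

lemma sum_entries: "(\<Sum>e\<in>entries d. f e) = (\<Sum>a\<in>{1..d}. f (Unbarred a) + f (Barred a))"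
proof -
  have "(\<Sum>e\<in>entries d. f e) = (\<Sum>e\<in>Unbarred ` {1..d}. f e) + (\<Sum>e\<in>Barred ` {1..d}. f e)"
    by (rule sum.union_disjoint) auto
  then show ?thesis
    by (simp add: sum.reindex inj_on_def sum.distrib)
qed

lemma sum_PiE_insert:
  assumes "b \<notin> B"
  shows "(\<Sum>U\<in>insert b B \<rightarrow>\<^sub>E E. f U) = (\<Sum>U\<in>B \<rightarrow>\<^sub>E E. \<Sum>e\<in>E. f (U(b := e)))"
proof -
  have "(\<Sum>U\<in>insert b B \<rightarrow>\<^sub>E E. f U) = (\<Sum>(e, U)\<in>E \<times> (B \<rightarrow>\<^sub>E E). f (U(b := e)))"
    unfolding PiE_insert_eq by (subst sum.reindex[OF inj_combinator[OF assms]]) (simp add: case_prod_unfold)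
  also have "\<dots> = (\<Sum>e\<in>E. \<Sum>U\<in>B \<rightarrow>\<^sub>E E. f (U(b := e)))"
    by (rule sum.cartesian_product[symmetric])
  also have "\<dots> = (\<Sum>U\<in>B \<rightarrow>\<^sub>E E. \<Sum>e\<in>E. f (U(b := e)))"
    by (rule sum.swap)
  finally show ?thesis .
qed

text \<open>The shape reached when the boxes \<open>ps\<close> have been read, starting from \<open>lam\<close>.\<close>

definition shape_after :: "(nat \<Rightarrow> nat) \<Rightarrow> (box \<Rightarrow> entry) \<Rightarrow> box list \<Rightarrow> nat \<Rightarrow> nat" where
  "shape_after lam U ps i = lam i + count_list (unbarred_entries U ps) i"

definition dominant :: "nat \<Rightarrow> (nat \<Rightarrow> nat) \<Rightarrow> (box \<Rightarrow> entry) \<Rightarrow> box list \<Rightarrow> bool" where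
  "dominant d lam U ps \<longleftrightarrow> (\<forall>qs. prefix qs ps \<longrightarrow> shape_after lam U qs \<in> partitions d)"

text \<open>For \<open>ps\<close> the full reading word this is the weight \<open>c\<^sub>L\<close>; for prefixes it is the part of the weight
collected so far.\<close>

definition bar_weight ::
    "nat \<Rightarrow> (nat \<Rightarrow> 'a::comm_ring_1) \<Rightarrow> (nat \<Rightarrow> nat) \<Rightarrow> (box \<Rightarrow> entry) \<Rightarrow> box list \<Rightarrow> 'a" where
  "bar_weight d y lam U ps =
     (\<Prod>b | b \<in> set ps \<and> is_barred (U b).
        y ((d + 1 - value_of (U b)) + shape_after lam U (takeWhile (\<lambda>b'. b' \<noteq> b) ps) (value_of (U b)))
        - y (yindex d (value_of (U b)) b))"

lemma unbarred_entries_cong: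
  assumes "\<And>b. b \<in> set ps \<Longrightarrow> U b = U' b"
  shows "unbarred_entries U ps = unbarred_entries U' ps"
proof -
  have "filter (\<lambda>b. \<not> is_barred (U b)) ps = filter (\<lambda>b. \<not> is_barred (U' b)) ps"
    by (rule filter_cong[OF refl]) (simp only: assms)
  moreover have "map (value_of \<circ> U) (filter P ps) = map (value_of \<circ> U') (filter P ps)" for P
    by (rule map_cong[OF refl]) (simp add: assms)
  ultimately show ?thesis
    unfolding unbarred_entries_def by simp
qed

lemma shape_after_cong:
  assumes "\<And>b. b \<in> set ps \<Longrightarrow> U b = U' b"
  shows "shape_after lam U ps = shape_after lam U' ps"
  using unbarred_entries_cong[OF assms] by (auto simp: shape_after_def)

lemma unbarred_entries_snoc:
  assumes "b \<notin> set ps"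
  shows "unbarred_entries (U(b := e)) (ps @ [b]) =
           unbarred_entries U ps @ (if is_barred e then [] else [value_of e])"
proof -
  have "unbarred_entries (U(b := e)) ps = unbarred_entries U ps"
  proof (rule unbarred_entries_cong)
    fix b' assume "b' \<in> set ps"
    then show "(U(b := e)) b' = U b'"
      using assms by (metis fun_upd_other)
  qed
  moreover have "unbarred_entries (U(b := e)) (ps @ [b]) =
      unbarred_entries (U(b := e)) ps @ unbarred_entries (U(b := e)) [b]"
    by (simp add: unbarred_entries_def del: fun_upd_apply)
  moreover have "unbarred_entries (U(b := e)) [b] = (if is_barred e then [] else [value_of e])"
    by (simp add: unbarred_entries_def)
  ultimately show ?thesis by simp
qed

lemma shape_after_Unbarred:
  assumes "b \<notin> set ps"
  shows "shape_after lam (U(b := Unbarred a)) (ps @ [b]) =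
           (shape_after lam U ps)(a := shape_after lam U ps a + 1)"
  by (rule ext) (simp add: shape_after_def unbarred_entries_snoc[OF assms])

lemma shape_after_Barred:
  assumes "b \<notin> set ps"
  shows "shape_after lam (U(b := Barred a)) (ps @ [b]) = shape_after lam U ps"
  by (rule ext) (simp add: shape_after_def unbarred_entries_snoc[OF assms])

lemma dominant_snoc:
  assumes "b \<notin> set ps"
  shows "dominant d lam (U(b := e)) (ps @ [b]) \<longleftrightarrow>
           dominant d lam U ps \<and> shape_after lam (U(b := e)) (ps @ [b]) \<in> partitions d"
proof -
  have same: "shape_after lam (U(b := e)) qs = shape_after lam U qs" if "prefix qs ps" for qs
  proof (rule shape_after_cong)
    fix b' assume "b' \<in> set qs"
    then have "b' \<noteq> b"
      using assms set_mono_prefix[OF that] by blast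
    then show "(U(b := e)) b' = U b'" by simp
  qed
  show ?thesis
    unfolding dominant_def prefix_snoc using same by metis
qed

lemma bar_weight_snoc:
  assumes "b \<notin> set ps"
  shows "bar_weight d y lam (U(b := e)) (ps @ [b]) = bar_weight d y lam U ps *
     (if is_barred e
      then y ((d + 1 - value_of e) + shape_after lam U ps (value_of e)) - y (yindex d (value_of e) b)
      else 1)"
proof -
  let ?U = "U(b := e)"
  let ?g = "\<lambda>U ps b. y ((d + 1 - value_of (U b)) +
      shape_after lam U (takeWhile (\<lambda>b'. b' \<noteq> b) ps) (value_of (U b))) - y (yindex d (value_of (U b)) b)"
  let ?B = "{b' \<in> set ps. is_barred (U b')}"
  have old: "prod (?g ?U (ps @ [b])) ?B = prod (?g U ps) ?B"
  proof (rule prod.cong[OF refl])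
    fix b' assume b': "b' \<in> ?B"
    then have ne: "b' \<noteq> b"
      using assms by auto
    have "takeWhile (\<lambda>b''. b'' \<noteq> b') (ps @ [b]) = takeWhile (\<lambda>b''. b'' \<noteq> b') ps"
      using b' by (intro takeWhile_append1) auto
    moreover have "shape_after lam ?U (takeWhile (\<lambda>b''. b'' \<noteq> b') ps) =
        shape_after lam U (takeWhile (\<lambda>b''. b'' \<noteq> b') ps)"
      using assms by (intro shape_after_cong) (auto dest: set_takeWhileD)
    ultimately show "?g ?U (ps @ [b]) b' = ?g U ps b'"
      using ne by simp
  qed
  have new: "?g ?U (ps @ [b]) b =
      y ((d + 1 - value_of e) + shape_after lam U ps (value_of e)) - y (yindex d (value_of e) b)"
  proof -
    have "takeWhile (\<lambda>b'. b' \<noteq> b) (ps @ [b]) = ps"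
      using assms by (subst takeWhile_append2) auto
    moreover have "shape_after lam ?U ps = shape_after lam U ps"
      using assms by (intro shape_after_cong) auto
    ultimately show ?thesis by simp
  qed
  have set: "{b' \<in> set (ps @ [b]). is_barred (?U b')} = (if is_barred e then insert b ?B else ?B)"
    using assms by auto
  have "b \<notin> ?B" "finite ?B"
    using assms by auto
  then show ?thesis
    unfolding bar_weight_def set using old new by (simp add: mult.commute)
qed

lemma not_dominant_step:
  assumes \<alpha>: "\<alpha> \<in> partitions d" and a: "a \<in> {1..d}" and bad: "\<alpha>(a := \<alpha> a + 1) \<notin> partitions d"
  shows "\<exists>k. 1 \<le> k \<and> a = Suc k \<and> \<alpha> k = \<alpha> a"
proof -
  have dec: "\<alpha> j \<le> \<alpha> i" if "1 \<le> i" "i \<le> j" "j \<le> d" for i j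
    using \<alpha> that by (auto simp: partitions_def)
  obtain i j where ij: "1 \<le> i" "i \<le> j" "j \<le> d" "(\<alpha>(a := \<alpha> a + 1)) i < (\<alpha>(a := \<alpha> a + 1)) j"
    using bad \<alpha> a by (auto simp: partitions_def not_le split: if_splits)
  then have j: "j = a" "i < a" "\<alpha> i < \<alpha> a + 1"
    using dec[OF ij(1-3)] by (auto split: if_splits)
  moreover have "\<alpha> (a - 1) \<le> \<alpha> i" "\<alpha> a \<le> \<alpha> (a - 1)"
    using ij j a dec[of i "a - 1"] dec[of "a - 1" a] by auto
  ultimately show ?thesis
    using ij by (intro exI[of _ "a - 1"]) auto
qed

text \<open>Reading one more box \<open>b\<close>: the completions are split by the value \<open>a\<close> at \<open>b\<close>, and the factor of \<open>b\<close> is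
absorbed by \<open>alternant_mult_linear\<close>. The term with \<open>a\<close> unbarred disappears if the new shape is not a
partition, because then the exponents at \<open>a - 1\<close> and \<open>a\<close> coincide.\<close>

lemma alternant_completion_step:
  fixes x y :: "nat \<Rightarrow> 'a::{idom,ring_char_0}"
  assumes \<mu>: "\<mu> \<in> partitions d" and eq: "reading_reverse d \<mu> = ps @ b # rs"
    and dom: "dominant d lam U ps"
  shows "bar_weight d y lam U ps *
           alternant d y (shape_after lam U ps) (completion_sum d \<mu> y (set ps) (value_of \<circ> U)) x =
         (\<Sum>e\<in>entries d. if dominant d lam (U(b := e)) (ps @ [b])
            then bar_weight d y lam (U(b := e)) (ps @ [b]) *
              alternant d y (shape_after lam (U(b := e)) (ps @ [b]))
                (completion_sum d \<mu> y (insert b (set ps)) (value_of \<circ> U(b := e))) x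
            else 0)" (is "?w * _ = sum ?g _")
proof -
  let ?\<alpha> = "shape_after lam U ps"
  let ?F = "\<lambda>a. completion_sum d \<mu> y (insert b (set ps)) ((value_of \<circ> U)(b := a))"
  have notin: "b \<notin> set ps"
    using distinct_reading_reverse[of d \<mu>] eq by auto
  have b: "b \<in> boxes d \<mu> - set ps"
    using set_reading_reverse[OF \<mu>] eq notin by auto
  have \<alpha>: "?\<alpha> \<in> partitions d"
    using dom by (simp add: dominant_def)
  have "completion_sum d \<mu> y (set ps) (value_of \<circ> U) =
      (\<lambda>z. \<Sum>a\<in>{1..d}. (z a - y (yindex d a b)) * ?F a z)"
    by (rule ext, rule completion_sum_split[OF b])
  then have "alternant d y ?\<alpha> (completion_sum d \<mu> y (set ps) (value_of \<circ> U)) x =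
      (\<Sum>a\<in>{1..d}. alternant d y ?\<alpha> (\<lambda>z. (z a - y (yindex d a b)) * ?F a z) x)"
    by (simp only: alternant_sum)
  also have "\<dots> = (\<Sum>a\<in>{1..d}. alternant d y (?\<alpha>(a := ?\<alpha> a + 1)) (?F a) x +
      (y ((d + 1 - a) + ?\<alpha> a) - y (yindex d a b)) * alternant d y ?\<alpha> (?F a) x)"
    by (rule sum.cong[OF refl], rule alternant_mult_linear)
  finally have expand: "alternant d y ?\<alpha> (completion_sum d \<mu> y (set ps) (value_of \<circ> U)) x =
      (\<Sum>a\<in>{1..d}. alternant d y (?\<alpha>(a := ?\<alpha> a + 1)) (?F a) x +
      (y ((d + 1 - a) + ?\<alpha> a) - y (yindex d a b)) * alternant d y ?\<alpha> (?F a) x)" .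
  show ?thesis
    unfolding expand sum_entries sum_distrib_left
  proof (rule sum.cong[OF refl])
    fix a assume a: "a \<in> {1..d}"
    have F: "completion_sum d \<mu> y (insert b (set ps)) (value_of \<circ> U(b := e)) = ?F (value_of e)" for e
      by (simp add: fun_upd_comp)
    have barred: "?g (Barred a) = ?w * ((y ((d + 1 - a) + ?\<alpha> a) - y (yindex d a b)) * alternant d y ?\<alpha> (?F a) x)"
      unfolding F dominant_snoc[OF notin] bar_weight_snoc[OF notin] shape_after_Barred[OF notin]
      using dom \<alpha> by (simp add: mult.assoc)
    have unbarred: "?g (Unbarred a) = ?w * alternant d y (?\<alpha>(a := ?\<alpha> a + 1)) (?F a) x"
    proof (cases "?\<alpha>(a := ?\<alpha> a + 1) \<in> partitions d")
      case True
      then show ?thesis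
        unfolding F dominant_snoc[OF notin] bar_weight_snoc[OF notin] shape_after_Unbarred[OF notin]
        using dom by simp
    next
      case False
      then obtain k where k: "1 \<le> k" "a = Suc k" "?\<alpha> k = ?\<alpha> a"
        using not_dominant_step[OF \<alpha> a] by blast
      have "alternant d y (?\<alpha>(a := ?\<alpha> a + 1)) (?F a) x = 0"
      proof (rule alternant_eq_0[of k])
        show "?F a (z \<circ> transpose k (Suc k)) = ?F a z" for z
          by (rule completion_sum_symmetric, rule completions_two_letters[OF \<mu> eq,
                where V = "(value_of \<circ> U)(b := a)"])
            (use k a in auto)
      qed (use k a in auto)
      moreover have "\<not> dominant d lam (U(b := Unbarred a)) (ps @ [b])"
        unfolding dominant_snoc[OF notin] shape_after_Unbarred[OF notin] using False by blast
      ultimately show ?thesis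
        by (simp only: if_False mult_zero_right)
    qed
    show "?w * (alternant d y (?\<alpha>(a := ?\<alpha> a + 1)) (?F a) x +
        (y ((d + 1 - a) + ?\<alpha> a) - y (yindex d a b)) * alternant d y ?\<alpha> (?F a) x) =
        ?g (Unbarred a) + ?g (Barred a)"
      unfolding barred unbarred by (rule distrib_left)
  qed
qed

text \<open>Interpolates between \<open>schur\<close> inserted into an alternant (no box read) and the full expansion (all
boxes read).\<close>

lemma alternant_schur_partial_expansion:
  fixes x y :: "nat \<Rightarrow> 'a::{idom,ring_char_0}"
  assumes lam: "lam \<in> partitions d" and \<mu>: "\<mu> \<in> partitions d"
    and ps: "prefix ps (reading_reverse d \<mu>)"
  shows "alternant d y lam (schur d \<mu> y) x =
     (\<Sum>U\<in>set ps \<rightarrow>\<^sub>E entries d. if dominant d lam U ps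
        then bar_weight d y lam U ps *
          alternant d y (shape_after lam U ps) (completion_sum d \<mu> y (set ps) (value_of \<circ> U)) x
        else 0)"
  using ps
proof (induction ps rule: rev_induct)
  case Nil
  have "shape_after lam U [] = lam" for U
    by (auto simp: shape_after_def unbarred_entries_def)
  then show ?case
    using lam by (simp add: dominant_def bar_weight_def schur_eq_completion_sum[symmetric])
next
  case (snoc b ps)
  then obtain rs where eq: "reading_reverse d \<mu> = ps @ b # rs"
    by (auto simp: prefix_def)
  have notin: "b \<notin> set ps"
    using distinct_reading_reverse[of d \<mu>] eq by auto
  show ?case
    unfolding snoc.IH[OF append_prefixD[OF snoc.prems]] set_append list.set Un_insert_right Un_empty_right
      sum_PiE_insert[OF notin]
  proof (rule sum.cong[OF refl], goal_cases)
    case (1 U)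
    show ?case
      using alternant_completion_step[OF \<mu> eq, of lam U y x]
      by (auto simp: dominant_snoc[OF notin])
  qed
qed

lemma completion_sum_full:
  assumes "U \<in> boxes d \<mu> \<rightarrow>\<^sub>E entries d"
  shows "completion_sum d \<mu> y (boxes d \<mu>) (value_of \<circ> U) x =
           (if increasing_reverse (boxes d \<mu>) (value_of \<circ> U) then 1 else 0)"
proof -
  let ?D = "boxes d \<mu>" and ?V = "value_of \<circ> U"
  let ?R = "restrict ?V ?D"
  have incr: "increasing_reverse ?D ?R \<longleftrightarrow> increasing_reverse ?D ?V"
    by (fastforce simp: increasing_reverse_def)
  have V: "?R \<in> ?D \<rightarrow>\<^sub>E {1..d}"
    using assms by (fastforce simp: PiE_iff)
  have unique: "R = ?R" if "R \<in> completions d \<mu> ?D ?V" for R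
    by (rule extensionalityI[where A = ?D])
      (use that in \<open>auto simp: completions_def reverse_tableaux_def PiE_def\<close>)
  have iff: "?R \<in> completions d \<mu> ?D ?V \<longleftrightarrow> increasing_reverse ?D ?V"
    using V incr by (simp add: completions_def reverse_tableaux_def)
  have "completions d \<mu> ?D ?V = (if increasing_reverse ?D ?V then {?R} else {})"
  proof (cases "increasing_reverse ?D ?V")
    case True
    then have "?R \<in> completions d \<mu> ?D ?V"
      using iff by blast
    then have "completions d \<mu> ?D ?V = {?R}"
      using unique by blast
    then show ?thesis
      using True by (simp only: if_True)
  next
    case False
    then have "completions d \<mu> ?D ?V = {}"
      using unique iff by (metis all_not_in_conv)
    then show ?thesis
      using False by (simp only: if_False)
  qed
  then show ?thesis
    unfolding completion_sum_def by simp
qed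

definition dominant_fillings :: "nat \<Rightarrow> (nat \<Rightarrow> nat) \<Rightarrow> (nat \<Rightarrow> nat) \<Rightarrow> (box \<Rightarrow> entry) set" where
  "dominant_fillings d lam \<mu> = {U \<in> boxes d \<mu> \<rightarrow>\<^sub>E entries d.
     increasing_reverse (boxes d \<mu>) (value_of \<circ> U) \<and> dominant d lam U (reading_reverse d \<mu>)}"

lemma finite_dominant_fillings: "finite (dominant_fillings d lam \<mu>)"
  unfolding dominant_fillings_def
  by (rule finite_subset[of _ "boxes d \<mu> \<rightarrow>\<^sub>E entries d"]) (auto intro!: finite_PiE finite_boxes)

lemma alternant_schur_expansion:
  fixes x y :: "nat \<Rightarrow> 'a::{idom,ring_char_0}"
  assumes lam: "lam \<in> partitions d" and \<mu>: "\<mu> \<in> partitions d"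
  defines "bs \<equiv> reading_reverse d \<mu>"
  shows "alternant d y lam (schur d \<mu> y) x =
     (\<Sum>U\<in>dominant_fillings d lam \<mu>. bar_weight d y lam U bs * alternant d y (shape_after lam U bs) (\<lambda>_. 1) x)"
proof -
  let ?D = "boxes d \<mu>"
  have "alternant d y lam (schur d \<mu> y) x =
     (\<Sum>U\<in>?D \<rightarrow>\<^sub>E entries d. if dominant d lam U bs
        then bar_weight d y lam U bs *
          alternant d y (shape_after lam U bs) (completion_sum d \<mu> y ?D (value_of \<circ> U)) x
        else 0)"
    using alternant_schur_partial_expansion[OF lam \<mu> prefix_order.refl, of y x]
    unfolding bs_def set_reading_reverse[OF \<mu>] .
  also have "\<dots> = (\<Sum>U\<in>?D \<rightarrow>\<^sub>E entries d. if U \<in> dominant_fillings d lam \<mu>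
        then bar_weight d y lam U bs * alternant d y (shape_after lam U bs) (\<lambda>_. 1) x else 0)"
  proof (rule sum.cong[OF refl])
    fix U assume U: "U \<in> ?D \<rightarrow>\<^sub>E entries d"
    have "completion_sum d \<mu> y ?D (value_of \<circ> U) =
        (\<lambda>_. if increasing_reverse ?D (value_of \<circ> U) then 1 else 0)"
      by (rule ext) (rule completion_sum_full[OF U])
    then show "(if dominant d lam U bs
        then bar_weight d y lam U bs *
          alternant d y (shape_after lam U bs) (completion_sum d \<mu> y ?D (value_of \<circ> U)) x
        else 0) = (if U \<in> dominant_fillings d lam \<mu>
        then bar_weight d y lam U bs * alternant d y (shape_after lam U bs) (\<lambda>_. 1) x else 0)"
      using U by (simp add: dominant_fillings_def bs_def alternant_zero)
  qed
  also have "\<dots> = (\<Sum>U\<in>dominant_fillings d lam \<mu>.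
      bar_weight d y lam U bs * alternant d y (shape_after lam U bs) (\<lambda>_. 1) x)"
    by (subst sum.inter_restrict[symmetric])
      (auto intro!: finite_PiE finite_boxes sum.cong simp: dominant_fillings_def)
  finally show ?thesis .
qed

section \<open>The bialternant formula\<close>

lemma count_list_map_eq_card:
  assumes "distinct ps"
  shows "count_list (map f ps) i = card {b \<in> set ps. f b = i}"
proof -
  have "count_list (map f ps) i = length (filter (\<lambda>b. f b = i) ps)"
    by (induction ps) auto
  also have "\<dots> = card (set (filter (\<lambda>b. f b = i) ps))"
    by (rule distinct_card[symmetric]) (simp add: assms)
  finally show ?thesis by simp
qed

lemma count_unbarred_eq_card:
  assumes "distinct ps"
  shows "count_list (unbarred_entries U ps) i = card {b \<in> set ps. U b = Unbarred i}"
proof -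
  have iff: "\<not> is_barred e \<and> value_of e = i \<longleftrightarrow> e = Unbarred i" for e
    by (cases e) auto
  have "count_list (unbarred_entries U ps) i =
      card {b \<in> set (filter (\<lambda>b. \<not> is_barred (U b)) ps). (value_of \<circ> U) b = i}"
    unfolding unbarred_entries_def using assms by (intro count_list_map_eq_card) simp
  also have "{b \<in> set (filter (\<lambda>b. \<not> is_barred (U b)) ps). (value_of \<circ> U) b = i} =
      {b \<in> set ps. U b = Unbarred i}"
    using iff by auto
  finally show ?thesis .
qed

lemma partitionsI:
  assumes "\<And>i. 1 \<le> i \<Longrightarrow> Suc i \<le> d \<Longrightarrow> f (Suc i) \<le> f i"
    and "\<And>i. i \<notin> {1..d} \<Longrightarrow> f i = 0"
  shows "f \<in> partitions d"
proof -
  have "f j \<le> f i" if "1 \<le> i" "i \<le> j" "j \<le> d" for i j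
    using that(2,3)
  proof (induction j rule: dec_induct)
    case (step n)
    then show ?case
      using assms(1)[of n] that(1) by simp
  qed simp
  then show ?thesis
    using assms(2) by (simp add: partitions_def)
qed

lemma zero_partition: "(\<lambda>_. 0) \<in> partitions d"
  by (simp add: partitions_def)

text \<open>The conjugate partition.\<close>

definition height :: "nat \<Rightarrow> (nat \<Rightarrow> nat) \<Rightarrow> nat \<Rightarrow> nat" where
  "height d \<mu> c = card {r \<in> {1..d}. c \<le> \<mu> r}"

lemma downward_closed_eq_interval:
  fixes A :: "nat set"
  assumes "finite A" "0 \<notin> A" and down: "\<And>a b. a \<in> A \<Longrightarrow> 1 \<le> b \<Longrightarrow> b \<le> a \<Longrightarrow> b \<in> A"
  shows "A = {1..card A}"
proof (cases "A = {}")
  case False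
  then have M: "Max A \<in> A"
    using assms(1) by simp
  have "A = {1..Max A}"
  proof (intro set_eqI iffI)
    fix a assume "a \<in> A"
    moreover from this have "a \<noteq> 0"
      using assms(2) by metis
    ultimately show "a \<in> {1..Max A}"
      using assms(1) by simp
  next
    fix a assume "a \<in> {1..Max A}"
    then show "a \<in> A"
      using down[OF M] by simp
  qed
  note iv = this
  have "card A = Max A"
    using arg_cong[OF iv, of card] by simp
  then show ?thesis
    by (intro trans[OF iv]) simp
qed simp

lemma boxes_iff_height:
  assumes \<mu>: "\<mu> \<in> partitions d"
  shows "(r, c) \<in> boxes d \<mu> \<longleftrightarrow> 1 \<le> c \<and> 1 \<le> r \<and> r \<le> height d \<mu> c"
proof -
  let ?A = "{r \<in> {1..d}. c \<le> \<mu> r}"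
  have "?A = {1..card ?A}"
  proof (rule downward_closed_eq_interval)
    fix a b assume "a \<in> ?A" "1 \<le> b" "b \<le> a"
    then show "b \<in> ?A"
      using \<mu> by (auto simp: partitions_def intro: le_trans)
  qed auto
  then have "r \<in> ?A \<longleftrightarrow> r \<in> {1..height d \<mu> c}"
    unfolding height_def by blast
  then show ?thesis
    by (auto simp: boxes_def)
qed

lemma height_le: "height d \<mu> c \<le> d"
proof -
  have "height d \<mu> c \<le> card {1..d}"
    unfolding height_def by (rule card_mono) auto
  then show ?thesis by simp
qed

lemma height_antimono: "c \<le> c' \<Longrightarrow> height d \<mu> c' \<le> height d \<mu> c"
  unfolding height_def by (rule card_mono) auto

text \<open>Every column of height \<open>h\<close> carries \<open>1, \<dots>, h\<close> from top to bottom, all unbarred.\<close>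

definition packed_filling :: "nat \<Rightarrow> (nat \<Rightarrow> nat) \<Rightarrow> box \<Rightarrow> entry" where
  "packed_filling d \<mu> = (\<lambda>b\<in>boxes d \<mu>. Unbarred (height d \<mu> (snd b) + 1 - fst b))"

lemma prefix_before_closed:
  assumes \<mu>: "\<mu> \<in> partitions d" and qs: "prefix qs (reading_reverse d \<mu>)"
    and b: "b \<in> set qs" and b': "b' \<in> boxes d \<mu>" "before_reverse b' b"
  shows "b' \<in> set qs"
proof (rule ccontr)
  assume n: "b' \<notin> set qs"
  obtain rs where eq: "reading_reverse d \<mu> = qs @ rs"
    using qs by (auto simp: prefix_def)
  have "b' \<in> set rs"
    using set_reading_reverse[OF \<mu>] b' n unfolding eq by auto
  then have "before_reverse b b'"
    using sorted_reading_reverse[of d \<mu>] b unfolding eq by (simp add: sorted_wrt_append)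
  then show False
    using b'(2) by (auto simp: before_reverse_def)
qed

text \<open>In a prefix of the reading word, every \<open>i + 1\<close> comes with the \<open>i\<close> directly above it, which is read
earlier.\<close>

lemma packed_dominant:
  assumes \<mu>: "\<mu> \<in> partitions d"
  shows "dominant d (\<lambda>_. 0) (packed_filling d \<mu>) (reading_reverse d \<mu>)"
  unfolding dominant_def
proof (intro allI impI)
  fix qs assume qs: "prefix qs (reading_reverse d \<mu>)"
  let ?U = "packed_filling d \<mu>"
  have dist: "distinct qs"
    using qs distinct_reading_reverse[of d \<mu>] by (auto simp: prefix_def)
  have sub: "set qs \<subseteq> boxes d \<mu>"
    using set_mono_prefix[OF qs] set_reading_reverse[OF \<mu>] by simp
  have at: "?U (r, c) = Unbarred i \<longleftrightarrow> i = height d \<mu> c + 1 - r" if "(r, c) \<in> boxes d \<mu>" for r c i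
    using that by (auto simp: packed_filling_def)
  show "shape_after (\<lambda>_. 0) ?U qs \<in> partitions d"
  proof (rule partitionsI)
    fix i :: nat assume i: "1 \<le> i" "Suc i \<le> d"
    have "card {b \<in> set qs. ?U b = Unbarred (Suc i)} \<le> card {b \<in> set qs. ?U b = Unbarred i}"
    proof (rule card_inj_on_le)
      show "inj_on (\<lambda>(r, c). (Suc r, c)) {b \<in> set qs. ?U b = Unbarred (Suc i)}"
        by (auto simp: inj_on_def)
      show "(\<lambda>(r, c). (Suc r, c)) ` {b \<in> set qs. ?U b = Unbarred (Suc i)} \<subseteq> {b \<in> set qs. ?U b = Unbarred i}"
      proof (rule image_subsetI)
        fix b assume b: "b \<in> {b \<in> set qs. ?U b = Unbarred (Suc i)}"
        obtain r c where rc: "b = (r, c)" by fastforce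
        have D: "(r, c) \<in> boxes d \<mu>" and in_qs: "(r, c) \<in> set qs"
          using b sub by (auto simp: rc)
        have eq: "Suc i = height d \<mu> c + 1 - r"
          using b at[OF D] by (simp add: rc)
        have D': "(Suc r, c) \<in> boxes d \<mu>"
          using D eq i unfolding boxes_iff_height[OF \<mu>] by simp
        have "before_reverse (Suc r, c) (r, c)"
          by (simp add: before_reverse_def)
        then have "(Suc r, c) \<in> set qs"
          by (rule prefix_before_closed[OF \<mu> qs in_qs D'])
        moreover have "?U (Suc r, c) = Unbarred i"
          using at[OF D', of i] eq by simp
        ultimately show "(case b of (r, c) \<Rightarrow> (Suc r, c)) \<in> {b \<in> set qs. ?U b = Unbarred i}"
          by (simp add: rc)
      qed
    qed simp
    then show "shape_after (\<lambda>_. 0) ?U qs (Suc i) \<le> shape_after (\<lambda>_. 0) ?U qs i"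
      by (simp add: shape_after_def count_unbarred_eq_card[OF dist])
  next
    fix i :: nat assume i: "i \<notin> {1..d}"
    have "?U (r, c) \<noteq> Unbarred i" if "(r, c) \<in> boxes d \<mu>" for r c
      using at[OF that, of i] that[unfolded boxes_iff_height[OF \<mu>]] height_le[of d \<mu> c] i by auto
    then have "{b \<in> set qs. ?U b = Unbarred i} = {}"
      using sub by auto
    then show "shape_after (\<lambda>_. 0) ?U qs i = 0"
      by (simp add: shape_after_def count_unbarred_eq_card[OF dist])
  qed
qed

lemma packed_shape:
  assumes \<mu>: "\<mu> \<in> partitions d"
  shows "shape_after (\<lambda>_. 0) (packed_filling d \<mu>) (reading_reverse d \<mu>) = \<mu>"
proof
  fix i
  let ?U = "packed_filling d \<mu>"
  have "{b \<in> boxes d \<mu>. ?U b = Unbarred i} = (\<lambda>c. (height d \<mu> c + 1 - i, c)) ` {1..\<mu> i}"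
  proof (intro set_eqI iffI)
    fix b assume b: "b \<in> {b \<in> boxes d \<mu>. ?U b = Unbarred i}"
    obtain r c where rc: "b = (r, c)" by fastforce
    have B: "(r, c) \<in> boxes d \<mu>" "?U (r, c) = Unbarred i"
      using b by (simp_all add: rc)
    have D: "1 \<le> c" "1 \<le> r" "r \<le> height d \<mu> c"
      using B(1) by (simp_all add: boxes_iff_height[OF \<mu>])
    have "i = height d \<mu> c + 1 - r"
      using B(2) by (simp add: B(1) packed_filling_def)
    then have i: "1 \<le> i" "i \<le> height d \<mu> c" and r: "r = height d \<mu> c + 1 - i"
      using D by auto
    then have "(i, c) \<in> boxes d \<mu>"
      using D(1) by (simp add: boxes_iff_height[OF \<mu>])
    then have "c \<in> {1..\<mu> i}"
      by (simp add: boxes_def)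
    then show "b \<in> (\<lambda>c. (height d \<mu> c + 1 - i, c)) ` {1..\<mu> i}"
      using r rc by blast
  next
    fix b assume "b \<in> (\<lambda>c. (height d \<mu> c + 1 - i, c)) ` {1..\<mu> i}"
    then obtain c where c: "c \<in> {1..\<mu> i}" and b: "b = (height d \<mu> c + 1 - i, c)" by blast
    then have "i \<in> {1..d}"
      using \<mu> by (auto simp: partitions_def)
    then have "(i, c) \<in> boxes d \<mu>"
      using c by (simp add: boxes_def)
    then have i: "1 \<le> c" "1 \<le> i" "i \<le> height d \<mu> c"
      by (simp_all add: boxes_iff_height[OF \<mu>])
    then have "(height d \<mu> c + 1 - i, c) \<in> boxes d \<mu>"
      unfolding boxes_iff_height[OF \<mu>] by auto
    then show "b \<in> {b \<in> boxes d \<mu>. ?U b = Unbarred i}"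
      using i by (simp add: b packed_filling_def)
  qed
  then have "card {b \<in> boxes d \<mu>. ?U b = Unbarred i} = \<mu> i"
    by (simp add: card_image inj_on_def)
  then show "shape_after (\<lambda>_. 0) ?U (reading_reverse d \<mu>) i = \<mu> i"
    by (simp add: shape_after_def count_unbarred_eq_card[OF distinct_reading_reverse] set_reading_reverse[OF \<mu>])
qed

lemma packed_in_dominant_fillings:
  assumes \<mu>: "\<mu> \<in> partitions d"
  shows "packed_filling d \<mu> \<in> dominant_fillings d (\<lambda>_. 0) \<mu>"
proof -
  let ?U = "packed_filling d \<mu>"
  have "?U \<in> boxes d \<mu> \<rightarrow>\<^sub>E entries d"
    unfolding packed_filling_def restrict_PiE
  proof (rule Pi_I)
    fix b assume b: "b \<in> boxes d \<mu>"
    obtain r c where rc: "b = (r, c)" by fastforce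
    have "height d \<mu> c + 1 - r \<in> {1..d}"
      using b[unfolded rc boxes_iff_height[OF \<mu>]] height_le[of d \<mu> c] by auto
    then show "Unbarred (height d \<mu> (snd b) + 1 - fst b) \<in> entries d"
      by (simp add: rc)
  qed
  moreover have "increasing_reverse (boxes d \<mu>) (value_of \<circ> ?U)"
    unfolding increasing_reverse_def
  proof (intro conjI allI impI)
    fix r c c' assume a: "(r, c) \<in> boxes d \<mu> \<and> (r, c') \<in> boxes d \<mu> \<and> c < c'"
    then have "height d \<mu> c' \<le> height d \<mu> c"
      by (intro height_antimono) simp
    then show "(value_of \<circ> ?U) (r, c') \<le> (value_of \<circ> ?U) (r, c)"
      using a by (simp add: packed_filling_def diff_le_mono)
  next
    fix r r' c assume a: "(r, c) \<in> boxes d \<mu> \<and> (r', c) \<in> boxes d \<mu> \<and> r < r'"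
    then have "r' \<le> height d \<mu> c"
      by (simp add: boxes_iff_height[OF \<mu>])
    then have "height d \<mu> c + 1 - r' < height d \<mu> c + 1 - r"
      using a by auto
    then show "(value_of \<circ> ?U) (r', c) < (value_of \<circ> ?U) (r, c)"
      using a by (simp add: packed_filling_def)
  qed
  ultimately show ?thesis
    using packed_dominant[OF \<mu>] by (simp add: dominant_fillings_def)
qed

lemma packed_weight:
  assumes \<mu>: "\<mu> \<in> partitions d"
  shows "bar_weight d y (\<lambda>_. 0) (packed_filling d \<mu>) (reading_reverse d \<mu>) = 1"
proof -
  have none: "{b \<in> boxes d \<mu>. is_barred (packed_filling d \<mu> b)} = {}"
    by (auto simp: packed_filling_def)
  show ?thesis
    unfolding bar_weight_def set_reading_reverse[OF \<mu>] none by simp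
qed

lemma strictly_decreasing_onto_interval:
  fixes f :: "nat \<Rightarrow> nat"
  assumes dec: "\<And>r r'. 1 \<le> r \<Longrightarrow> r < r' \<Longrightarrow> r' \<le> h \<Longrightarrow> f r' < f r"
    and h: "1 \<le> h" and pos: "\<And>r. 1 \<le> r \<Longrightarrow> r \<le> h \<Longrightarrow> 1 \<le> f r"
    and onto: "\<And>i. 1 \<le> i \<Longrightarrow> i \<le> f 1 \<Longrightarrow> i \<in> f ` {1..h}"
    and r: "1 \<le> r" "r \<le> h"
  shows "f r = h + 1 - r"
proof -
  have slope: "f r' + r' \<le> f r + r" if "1 \<le> r" "r \<le> r'" "r' \<le> h" for r r'
    using that(2,3)
  proof (induction r' rule: dec_induct)
    case (step n)
    then show ?case
      using dec[of n "Suc n"] that(1) by simp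
  qed simp
  have le: "f r \<le> f 1" if "1 \<le> r" "r \<le> h" for r
    using dec[of 1 r] that by (cases "r = 1") auto
  have "f ` {1..h} = {1..f 1}"
    using onto pos le by (auto simp: image_subset_iff)
  moreover have "inj_on f {1..h}"
  proof (rule linorder_inj_onI)
    fix r r' assume "r < r'" "r \<in> {1..h}" "r' \<in> {1..h}"
    then show "f r \<noteq> f r'"
      using dec[of r r'] by simp
  qed auto
  ultimately have "f 1 = h"
    by (metis card_image card_atLeastAtMost diff_Suc_1)
  then have "f r + r \<le> h + 1"
    using slope[of 1 r] r by simp
  moreover have "h + 1 \<le> f r + r"
    using slope[of r h] pos[of h] r h by simp
  ultimately show ?thesis by simp
qed

lemma entry_eqI: "\<not> is_barred e \<Longrightarrow> value_of e = a \<Longrightarrow> e = Unbarred a"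
  by (cases e) auto

text \<open>The bottom entry \<open>a\<close> of column \<open>c\<close> is at most the height of each earlier column, so each of those
contains exactly one \<open>a\<close>, and just before the bottom box \<open>a\<close> has been read \<open>c - 1\<close> times. If \<open>a\<close> were
barred, its factor would be \<open>y\<close> minus \<open>y\<close>, both with index \<open>a' + c - 1\<close>, and the weight would vanish.
So \<open>a\<close> is unbarred and now occurs \<open>c\<close> times. By dominance every \<open>i \<le> a\<close> occurs at least \<open>c\<close> times,
whereas the earlier columns contain it \<open>c - 1\<close> times. Hence column \<open>c\<close> contains each of \<open>1, \<dots>, a\<close>
unbarred, and nothing else.\<close>

lemma column_packed:
  assumes \<mu>: "\<mu> \<in> partitions d" and U: "U \<in> dominant_fillings d (\<lambda>_. 0) \<mu>"
    and weight: "bar_weight d y (\<lambda>_. 0) U (reading_reverse d \<mu>) \<noteq> 0"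
    and previous: "\<And>r c'. c' < c \<Longrightarrow> (r, c') \<in> boxes d \<mu> \<Longrightarrow> U (r, c') = Unbarred (height d \<mu> c' + 1 - r)"
    and rc: "(r, c) \<in> boxes d \<mu>"
  shows "U (r, c) = Unbarred (height d \<mu> c + 1 - r)"
proof -
  let ?D = "boxes d \<mu>" and ?bs = "reading_reverse d \<mu>"
  let ?V = "value_of \<circ> U"
  define h where "h = height d \<mu> c"
  define a where "a = ?V (1, c)"
  have incr: "increasing_reverse ?D ?V" and dom: "dominant d (\<lambda>_. 0) U ?bs"
    and UE: "U \<in> ?D \<rightarrow>\<^sub>E entries d"
    using U by (auto simp: dominant_fillings_def)
  have D: "(r', c) \<in> ?D \<longleftrightarrow> 1 \<le> r' \<and> r' \<le> h" for r'
    using rc by (simp add: boxes_iff_height[OF \<mu>] h_def)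
  have c1: "1 \<le> c" and h1: "1 \<le> h"
    using rc by (auto simp: boxes_iff_height[OF \<mu>] h_def)
  have D1: "(1, c) \<in> ?D"
    using D h1 by simp
  have val: "?V b \<in> {1..d}" if "b \<in> ?D" for b
    using PiE_mem[OF UE that] by auto
  obtain ps rs where eq: "?bs = ps @ (1, c) # rs"
    using split_list[of "(1, c)" ?bs] D1 set_reading_reverse[OF \<mu>] by blast
  have ps: "set ps = {(r', c') \<in> ?D. c' < c \<or> c' = c \<and> 1 < r'}"
    by (rule reading_reverse_split[OF \<mu> eq])
  have dist: "distinct (ps @ [(1, c)])"
    using distinct_reading_reverse[of d \<mu>] unfolding eq by auto
  have ps1: "set (ps @ [(1, c)]) = {b \<in> ?D. snd b < c} \<union> {b \<in> ?D. snd b = c}"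
  proof -
    have "{b \<in> ?D. snd b = c} \<subseteq> insert (1, c) {(r', c') \<in> ?D. c' = c \<and> 1 < r'}"
      using D by fastforce
    then show ?thesis
      unfolding set_append list.set ps using D1 by fastforce
  qed
  have earlier: "card {b \<in> ?D. snd b < c \<and> U b = Unbarred i} = c - 1" if i: "1 \<le> i" "i \<le> a" for i
  proof -
    have height: "i \<le> height d \<mu> c'" if c': "1 \<le> c'" "c' < c" for c'
    proof -
      have D': "(1, c') \<in> ?D"
        by (rule boxes_downward_closed[OF \<mu> D1]) (use c' in auto)
      then have "a \<le> ?V (1, c')"
        using incr D1 c' by (simp add: increasing_reverse_def a_def)
      also have "\<dots> = height d \<mu> c'"
        using previous[OF c'(2) D'] by simp
      finally show ?thesis
        using i by simp
    qed
    have "{b \<in> ?D. snd b < c \<and> U b = Unbarred i} = (\<lambda>c'. (height d \<mu> c' + 1 - i, c')) ` {1..<c}"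
    proof (intro set_eqI iffI)
      fix b assume b: "b \<in> {b \<in> ?D. snd b < c \<and> U b = Unbarred i}"
      obtain r' c' where rc': "b = (r', c')" by fastforce
      have B: "(r', c') \<in> ?D" "c' < c" "U (r', c') = Unbarred i"
        using b by (auto simp: rc')
      have "i = height d \<mu> c' + 1 - r'"
        using previous[OF B(2,1)] B(3) by simp
      moreover have "1 \<le> c'" "r' \<le> height d \<mu> c'"
        using B(1) by (auto simp: boxes_iff_height[OF \<mu>])
      ultimately show "b \<in> (\<lambda>c'. (height d \<mu> c' + 1 - i, c')) ` {1..<c}"
        using B(2) by (intro image_eqI[of _ _ c']) (auto simp: rc')
    next
      fix b assume "b \<in> (\<lambda>c'. (height d \<mu> c' + 1 - i, c')) ` {1..<c}"
      then obtain c' where c': "1 \<le> c'" "c' < c" and b: "b = (height d \<mu> c' + 1 - i, c')" by auto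
      have "(height d \<mu> c' + 1 - i, c') \<in> ?D"
        unfolding boxes_iff_height[OF \<mu>] using c' height[OF c'] i by auto
      then show "b \<in> {b \<in> ?D. snd b < c \<and> U b = Unbarred i}"
        using previous[OF c'(2), of "height d \<mu> c' + 1 - i"] height[OF c'] c' by (simp add: b)
    qed
    then show ?thesis
      by (simp add: card_image inj_on_def)
  qed
  have strict: "?V (r'', c) < ?V (r', c)" if "1 \<le> r'" "r' < r''" "r'' \<le> h" for r' r''
    using incr that D[of r'] D[of r''] unfolding increasing_reverse_def by simp
  have a1: "1 \<le> a" "a \<le> d"
    using val[OF D1] by (auto simp: a_def)
  have count_before: "shape_after (\<lambda>_. 0) U ps a = c - 1"
  proof -
    have "{b \<in> set ps. U b = Unbarred a} = {b \<in> ?D. snd b < c \<and> U b = Unbarred a}"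
    proof (intro set_eqI iffI)
      fix b assume b: "b \<in> {b \<in> set ps. U b = Unbarred a}"
      obtain r' c' where rc': "b = (r', c')" by fastforce
      have "\<not> (c' = c \<and> 1 < r')"
      proof
        assume "c' = c \<and> 1 < r'"
        then have "?V (r', c) < a"
          unfolding a_def using strict[of 1 r'] b ps D[of r'] by (auto simp: rc')
        then show False
          using b \<open>c' = c \<and> 1 < r'\<close> by (simp add: rc')
      qed
      then show "b \<in> {b \<in> ?D. snd b < c \<and> U b = Unbarred a}"
        using b ps by (auto simp: rc')
    qed (use ps in auto)
    then show ?thesis
      using earlier[OF a1(1) order.refl] dist by (simp add: shape_after_def count_unbarred_eq_card)
  qed
  have "\<not> is_barred (U (1, c))"
  proof
    assume barred: "is_barred (U (1, c))"
    have take: "takeWhile (\<lambda>b'. b' \<noteq> (1, c)) ?bs = ps"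
      unfolding eq using dist by (subst takeWhile_append2) auto
    have "y ((d + 1 - value_of (U (1, c))) +
          shape_after (\<lambda>_. 0) U (takeWhile (\<lambda>b'. b' \<noteq> (1, c)) ?bs) (value_of (U (1, c))))
        - y (yindex d (value_of (U (1, c))) (1, c)) = 0"
      unfolding take using count_before c1 by (simp add: a_def yindex_def)
    then have "bar_weight d y (\<lambda>_. 0) U ?bs = 0"
      unfolding bar_weight_def using barred D1 set_reading_reverse[OF \<mu>] finite_boxes[of d \<mu>]
      by (intro prod_zero bexI[of _ "(1, c)"]) auto
    then show False
      using weight by contradiction
  qed
  then have Ua: "U (1, c) = Unbarred a"
    by (rule entry_eqI) (simp add: a_def)
  have "prefix (ps @ [(1, c)]) ?bs"
    unfolding eq by simp
  then have part: "shape_after (\<lambda>_. 0) U (ps @ [(1, c)]) \<in> partitions d"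
    using dom unfolding dominant_def by blast
  have total: "shape_after (\<lambda>_. 0) U (ps @ [(1, c)]) i =
      c - 1 + card {b \<in> ?D. snd b = c \<and> U b = Unbarred i}" if i: "1 \<le> i" "i \<le> a" for i
  proof -
    have "{b \<in> set (ps @ [(1, c)]). U b = Unbarred i} =
        {b \<in> ?D. snd b < c \<and> U b = Unbarred i} \<union> {b \<in> ?D. snd b = c \<and> U b = Unbarred i}"
      unfolding ps1 by blast
    then have "card {b \<in> set (ps @ [(1, c)]). U b = Unbarred i} =
        card {b \<in> ?D. snd b < c \<and> U b = Unbarred i} + card {b \<in> ?D. snd b = c \<and> U b = Unbarred i}"
      by (simp only:) (rule card_Un_disjoint, auto simp: finite_boxes)
    then show ?thesis
      unfolding shape_after_def count_unbarred_eq_card[OF dist] using earlier[OF i] by (simp only: add_0)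
  qed
  have occurs: "\<exists>r'. 1 \<le> r' \<and> r' \<le> h \<and> U (r', c) = Unbarred i" if i: "1 \<le> i" "i \<le> a" for i
  proof -
    have "card {b \<in> ?D. snd b = c \<and> U b = Unbarred a} \<ge> 1"
      using D1 Ua finite_boxes[of d \<mu>] by (auto simp: Suc_le_eq card_gt_0_iff)
    then have "c \<le> shape_after (\<lambda>_. 0) U (ps @ [(1, c)]) a"
      using total[of a] a1 c1 by simp
    also have "\<dots> \<le> shape_after (\<lambda>_. 0) U (ps @ [(1, c)]) i"
      using part i a1 by (simp add: partitions_def)
    also have "\<dots> = c - 1 + card {b \<in> ?D. snd b = c \<and> U b = Unbarred i}"
      by (rule total[OF i])
    finally have "card {b \<in> ?D. snd b = c \<and> U b = Unbarred i} \<noteq> 0"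
      using c1 by simp
    then obtain b where "b \<in> ?D" "snd b = c" "U b = Unbarred i"
      by (metis (mono_tags, lifting) card.empty empty_Collect_eq)
    then show ?thesis
      using D[of "fst b"] by (metis prod.collapse)
  qed
  have fr: "?V (r', c) = h + 1 - r'" if "1 \<le> r'" "r' \<le> h" for r'
  proof (rule strictly_decreasing_onto_interval[where f = "\<lambda>r. ?V (r, c)"])
    show "1 \<le> ?V (r, c)" if "1 \<le> r" "r \<le> h" for r
      using val[of "(r, c)"] D[of r] that by simp
    show "i \<in> (\<lambda>r. ?V (r, c)) ` {1..h}" if i: "1 \<le> i" "i \<le> ?V (1, c)" for i
    proof -
      obtain r' where r': "1 \<le> r'" "r' \<le> h" "U (r', c) = Unbarred i"
        using occurs[of i] i by (auto simp: a_def)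
      then show ?thesis
        by (intro image_eqI[of _ _ r']) auto
    qed
  qed (use that h1 strict in auto)
  have r: "1 \<le> r" "r \<le> h"
    using rc D by auto
  have "h + 1 - r \<le> a"
    using fr[of 1] h1 r by (simp add: a_def)
  moreover have "1 \<le> h + 1 - r"
    using r by simp
  ultimately obtain r' where r': "1 \<le> r'" "r' \<le> h" "U (r', c) = Unbarred (h + 1 - r)"
    using occurs[of "h + 1 - r"] by blast
  then have "h + 1 - r = h + 1 - r'"
    using fr[of r'] by simp
  then have "r' = r"
    using r r' by simp
  then show ?thesis
    using r' by (simp add: h_def)
qed

lemma nonzero_weight_imp_packed:
  assumes \<mu>: "\<mu> \<in> partitions d" and U: "U \<in> dominant_fillings d (\<lambda>_. 0) \<mu>"
    and weight: "bar_weight d y (\<lambda>_. 0) U (reading_reverse d \<mu>) \<noteq> 0"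
  shows "U = packed_filling d \<mu>"
proof (rule extensionalityI[where A = "boxes d \<mu>"])
  have column: "(r, c) \<in> boxes d \<mu> \<Longrightarrow> U (r, c) = Unbarred (height d \<mu> c + 1 - r)" for r c
  proof (induction c arbitrary: r rule: less_induct)
    case (less c)
    show ?case
      by (rule column_packed[OF \<mu> U weight less.IH less.prems])
  qed
  fix b assume "b \<in> boxes d \<mu>"
  then show "U b = packed_filling d \<mu> b"
    using column[of "fst b" "snd b"] by (simp add: packed_filling_def)
next
  show "U \<in> extensional (boxes d \<mu>)"
    using U by (auto simp: dominant_fillings_def PiE_def)
qed (simp add: packed_filling_def)

text \<open>The expansion from the empty shape has a single nonzero term, of weight 1 and shape \<open>\<mu>\<close>.\<close>

lemma alternant_zero_schur:
  fixes x y :: "nat \<Rightarrow> 'a::{idom,ring_char_0}"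
  assumes \<mu>: "\<mu> \<in> partitions d"
  shows "alternant d y (\<lambda>_. 0) (schur d \<mu> y) x = alternant d y \<mu> (\<lambda>_. 1) x"
proof -
  let ?bs = "reading_reverse d \<mu>"
  let ?f = "\<lambda>U. bar_weight d y (\<lambda>_. 0) U ?bs * alternant d y (shape_after (\<lambda>_. 0) U ?bs) (\<lambda>_. 1) x"
  have "alternant d y (\<lambda>_. 0) (schur d \<mu> y) x = sum ?f (dominant_fillings d (\<lambda>_. 0) \<mu>)"
    by (rule alternant_schur_expansion[OF zero_partition \<mu>])
  also have "\<dots> = sum ?f {packed_filling d \<mu>}"
  proof (rule sum.mono_neutral_right[OF finite_dominant_fillings])
    show "\<forall>U\<in>dominant_fillings d (\<lambda>_. 0) \<mu> - {packed_filling d \<mu>}. ?f U = 0"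
    proof
      fix U assume "U \<in> dominant_fillings d (\<lambda>_. 0) \<mu> - {packed_filling d \<mu>}"
      then have "bar_weight d y (\<lambda>_. 0) U ?bs = 0"
        using nonzero_weight_imp_packed[OF \<mu>] by blast
      then show "?f U = 0" by (simp only: mult_zero_left)
    qed
  qed (use packed_in_dominant_fillings[OF \<mu>] in simp)
  also have "\<dots> = alternant d y \<mu> (\<lambda>_. 1) x"
    by (simp add: packed_weight[OF \<mu>] packed_shape[OF \<mu>])
  finally show ?thesis .
qed

theorem bialternant:
  fixes x y :: "nat \<Rightarrow> 'a::{idom,ring_char_0}"
  assumes \<mu>: "\<mu> \<in> partitions d"
  shows "alternant d y (\<lambda>_. 0) (\<lambda>_. 1) x * schur d \<mu> y x = alternant d y \<mu> (\<lambda>_. 1) x"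
  using alternant_symmetric[of d "schur d \<mu> y" y "\<lambda>_. 0" x, OF schur_symmetric[OF \<mu>]] alternant_zero_schur[OF \<mu>, of y x] by simp

section \<open>Linear independence of the alternants\<close>

definition monomial_at :: "(nat \<Rightarrow> 'a::comm_ring_1) \<Rightarrow> (nat \<Rightarrow>\<^sub>0 nat) \<Rightarrow> 'a" where
  "monomial_at X m = (\<Prod>i\<in>Poly_Mapping.keys m. X i ^ Poly_Mapping.lookup m i)"

text \<open>Substitution of \<open>X i\<close> for \<open>x\<^sub>i\<close>; below, the coefficients and the values both lie in \<open>\<complex>[y]\<close>.\<close>

definition eval_at :: "(nat \<Rightarrow> 'a::comm_ring_1) \<Rightarrow> ((nat \<Rightarrow>\<^sub>0 nat) \<Rightarrow>\<^sub>0 'a) \<Rightarrow> 'a" where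
  "eval_at X p = (\<Sum>m\<in>Poly_Mapping.keys p. Poly_Mapping.lookup p m * monomial_at X m)"

lemma monomial_at_superset:
  assumes "finite A" "Poly_Mapping.keys m \<subseteq> A"
  shows "monomial_at X m = (\<Prod>i\<in>A. X i ^ Poly_Mapping.lookup m i)"
  unfolding monomial_at_def using assms
  by (intro prod.mono_neutral_left) (auto simp: in_keys_iff)

lemma monomial_at_add: "monomial_at X (m + n) = monomial_at X m * monomial_at X n"
proof -
  let ?A = "Poly_Mapping.keys m \<union> Poly_Mapping.keys n"
  have "monomial_at X (m + n) = (\<Prod>i\<in>?A. X i ^ Poly_Mapping.lookup (m + n) i)"
    using Poly_Mapping.keys_add[of m n] by (intro monomial_at_superset) auto
  then show ?thesis
    by (simp add: monomial_at_superset[of ?A m] monomial_at_superset[of ?A n]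
        lookup_add power_add prod.distrib)
qed

lemma eval_at_superset:
  assumes "finite A" "Poly_Mapping.keys p \<subseteq> A"
  shows "eval_at X p = (\<Sum>m\<in>A. Poly_Mapping.lookup p m * monomial_at X m)"
  unfolding eval_at_def using assms
  by (intro sum.mono_neutral_left) (auto simp: in_keys_iff)

lemma eval_at_add: "eval_at X (p + q) = eval_at X p + eval_at X q"
proof -
  let ?A = "Poly_Mapping.keys p \<union> Poly_Mapping.keys q"
  have "eval_at X (p + q) = (\<Sum>m\<in>?A. Poly_Mapping.lookup (p + q) m * monomial_at X m)"
    using Poly_Mapping.keys_add[of p q] by (intro eval_at_superset) auto
  then show ?thesis
    by (simp add: eval_at_superset[of ?A p] eval_at_superset[of ?A q]
        lookup_add distrib_right sum.distrib)
qed

lemma eval_at_single: "eval_at X (Poly_Mapping.single m c) = c * monomial_at X m"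
  by (cases "c = 0") (simp_all add: eval_at_def)

lemma eval_at_zero: "eval_at X 0 = 0"
  by (simp add: eval_at_def)

lemma eval_at_sum: "eval_at X (\<Sum>i\<in>I. f i) = (\<Sum>i\<in>I. eval_at X (f i))"
  by (induction I rule: infinite_finite_induct) (simp_all add: eval_at_zero eval_at_add)

lemma eval_at_uminus: "eval_at X (- p) = - eval_at X p"
  using eval_at_add[of X p "- p"] by (simp add: eval_at_zero add_eq_0_iff)

lemma eval_at_diff: "eval_at X (p - q) = eval_at X p - eval_at X q"
  using eval_at_add[of X p "- q"] by (simp add: eval_at_uminus)

lemma eq_sum_of_singles: "p = (\<Sum>m\<in>Poly_Mapping.keys p. Poly_Mapping.single m (Poly_Mapping.lookup p m))"
  by (rule poly_mapping_eqI)
    (simp add: lookup_sum lookup_single when_def in_keys_iff)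

lemma eval_at_mult: "eval_at X (p * q) = eval_at X p * eval_at X q"
proof -
  let ?s = "\<lambda>p. \<Sum>m\<in>Poly_Mapping.keys p. Poly_Mapping.single m (Poly_Mapping.lookup p m)"
  have "eval_at X (p * q) = eval_at X (?s p * ?s q)"
    using eq_sum_of_singles[of p] eq_sum_of_singles[of q] by simp
  also have "\<dots> = (\<Sum>m\<in>Poly_Mapping.keys p. \<Sum>n\<in>Poly_Mapping.keys q.
      (Poly_Mapping.lookup p m * Poly_Mapping.lookup q n) * (monomial_at X m * monomial_at X n))"
    unfolding sum_product eval_at_sum by (simp add: mult_single eval_at_single monomial_at_add)
  also have "\<dots> = eval_at X p * eval_at X q"
    unfolding eval_at_def sum_product by (simp add: mult_ac)
  finally show ?thesis .
qed

lemma eval_at_one: "eval_at X 1 = 1"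
  using eval_at_single[of X 0 1] by (simp add: monomial_at_def)

lemma eval_at_prod: "eval_at X (\<Prod>i\<in>I. f i) = (\<Prod>i\<in>I. eval_at X (f i))"
  by (induction I rule: infinite_finite_induct) (simp_all add: eval_at_one eval_at_mult)

lemma eval_at_const: "eval_at X (const c) = c"
  unfolding const_def by (simp add: eval_at_single monomial_at_def)

lemma eval_at_xvar: "eval_at X (xvar i) = X i"
  unfolding xvar_def by (simp add: eval_at_single monomial_at_def)

lemma eval_at_sign: "eval_at X (of_int (sign w)) = of_int (sign w)"
  by (simp add: sign_def eval_at_one eval_at_uminus)

lemma eval_at_alternant:
  "eval_at X (alternant d (\<lambda>i. const (yvar i)) \<alpha> (\<lambda>_. 1) xvar) = alternant d yvar \<alpha> (\<lambda>_. 1) X"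
  unfolding alternant_def ypow_def
  by (simp add: eval_at_sum eval_at_mult eval_at_prod eval_at_diff eval_at_const eval_at_xvar
      eval_at_sign)

lemma yvar_inject: "yvar i = yvar j \<longleftrightarrow> i = j"
proof
  assume "yvar i = yvar j"
  then have "Poly_Mapping.keys (yvar i) = Poly_Mapping.keys (yvar j)" by simp
  then have "Poly_Mapping.single i (1::nat) = Poly_Mapping.single j 1"
    by (simp add: yvar_def)
  then have "Poly_Mapping.keys (Poly_Mapping.single i (1::nat)) = Poly_Mapping.keys (Poly_Mapping.single j (1::nat))"
    by simp
  then show "i = j" by simp
qed simp

lemma ypow_yvar_eq_0_iff: "ypow yvar (yvar (Suc q)) p = 0 \<longleftrightarrow> q < p"
  by (auto simp: ypow_def yvar_inject)

text \<open>The exponents \<open>\<alpha>\<^sub>j + d - j\<close> of an alternant; for a partition they decrease strictly.\<close>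

definition shifted :: "nat \<Rightarrow> (nat \<Rightarrow> nat) \<Rightarrow> nat \<Rightarrow> nat" where
  "shifted d \<alpha> j = \<alpha> j + d - j"

lemma shifted_less:
  assumes "\<alpha> \<in> partitions d" "1 \<le> i" "i < j" "j \<le> d"
  shows "shifted d \<alpha> j < shifted d \<alpha> i"
proof -
  have "\<alpha> j \<le> \<alpha> i"
    using assms by (simp add: partitions_def)
  then show ?thesis
    using assms by (simp add: shifted_def)
qed

lemma shifted_antimono:
  assumes "\<alpha> \<in> partitions d" "1 \<le> i" "i \<le> j" "j \<le> d"
  shows "shifted d \<alpha> j \<le> shifted d \<alpha> i"
  using shifted_less[OF assms(1,2), of j] assms by (cases "i = j") auto

lemma shifted_le_iff: "j \<in> {1..d} \<Longrightarrow> shifted d \<alpha> j \<le> shifted d \<beta> j \<longleftrightarrow> \<alpha> j \<le> \<beta> j"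
  by (auto simp: shifted_def)

text \<open>By the pigeonhole principle some \<open>i \<le> j\<close> has \<open>w i \<ge> j\<close>; compare at \<open>i\<close> and use monotonicity on
both sides.\<close>

lemma dominated_if_permutation_dominated:
  assumes \<alpha>: "\<alpha> \<in> partitions d" and \<kappa>: "\<kappa> \<in> partitions d" and w: "w permutes {1..d}"
    and le: "\<And>j. j \<in> {1..d} \<Longrightarrow> shifted d \<alpha> j \<le> shifted d \<kappa> (w j)" and j: "j \<in> {1..d}"
  shows "\<alpha> j \<le> \<kappa> j"
proof -
  have "\<exists>i\<in>{1..j}. j \<le> w i"
  proof (rule ccontr)
    assume none: "\<not> (\<exists>i\<in>{1..j}. j \<le> w i)"
    have "w ` {1..j} \<subseteq> {1..<j}"
    proof (rule image_subsetI)
      fix i assume i: "i \<in> {1..j}"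
      then have "w i \<in> {1..d}"
        using permutes_in_image[OF w, of i] j by simp
      then show "w i \<in> {1..<j}"
        using none i by (auto simp: not_le)
    qed
    then have "card {1..j} \<le> card {1..<j}"
      using permutes_inj_on[OF w, of "{1..j}"] by (intro card_inj_on_le[of w]) auto
    then show False
      using j by auto
  qed
  then obtain i where i: "1 \<le> i" "i \<le> j" "j \<le> w i" by auto
  have wi: "w i \<in> {1..d}"
    using permutes_in_image[OF w, of i] i j by simp
  have "shifted d \<alpha> j \<le> shifted d \<alpha> i"
    by (rule shifted_antimono[OF \<alpha>]) (use i j in auto)
  also have "\<dots> \<le> shifted d \<kappa> (w i)"
    by (rule le) (use i j in auto)
  also have "\<dots> \<le> shifted d \<kappa> j"
    by (rule shifted_antimono[OF \<kappa>]) (use i j wi in auto)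
  finally show ?thesis
    using shifted_le_iff[OF j] by blast
qed

lemma permutation_dominated_self_imp_id:
  assumes \<kappa>: "\<kappa> \<in> partitions d" and w: "w permutes {1..d}"
    and le: "\<And>j. j \<in> {1..d} \<Longrightarrow> shifted d \<kappa> j \<le> shifted d \<kappa> (w j)"
  shows "w = id"
proof
  fix j
  \<comment> \<open>A permutation with \<open>w j \<le> j\<close> for all \<open>j\<close> is the identity, as the two sides have the same sum.\<close>
  have w_le: "w j \<le> j" if "j \<in> {1..d}" for j
  proof (rule ccontr)
    assume "\<not> w j \<le> j"
    then have "shifted d \<kappa> (w j) < shifted d \<kappa> j"
      using permutes_in_image[OF w, of j] that by (intro shifted_less[OF \<kappa>]) auto
    then show False
      using le[OF that] by simp
  qed
  have sum: "(\<Sum>j\<in>{1..d}. w j) = (\<Sum>j\<in>{1..d}. j)"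
    using sum.permute[OF w, of "\<lambda>j. j"] by (simp add: o_def)
  show "w j = id j"
  proof (cases "j \<in> {1..d}")
    case True
    have "w j = j"
    proof (rule ccontr)
      assume "w j \<noteq> j"
      then have "(\<Sum>j\<in>{1..d}. w j) < (\<Sum>j\<in>{1..d}. j)"
        using w_le True by (intro sum_strict_mono_ex1) (auto intro!: bexI[of _ j] simp: le_less)
      then show False
        using sum by simp
    qed
    then show ?thesis by simp
  qed (simp add: permutes_not_in[OF w])
qed

text \<open>At \<open>u = y\<^sub>q\<^sub>+\<^sub>1\<close> the factorial power \<open>(u|y)\<^sup>p\<close> vanishes exactly for \<open>p > q\<close>. At this point,
therefore, an alternant sees only exponents bounded by those of \<open>\<kappa>\<close>.\<close>

definition partition_point :: "nat \<Rightarrow> (nat \<Rightarrow> nat) \<Rightarrow> nat \<Rightarrow> ypoly" where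
  "partition_point d \<kappa> j = yvar (Suc (shifted d \<kappa> j))"

lemma alternant_at_partition_point:
  "alternant d yvar \<alpha> (\<lambda>_. 1) (partition_point d \<kappa>) =
     (\<Sum>w | w permutes {1..d}. of_int (sign w) *
        (\<Prod>j\<in>{1..d}. ypow yvar (yvar (Suc (shifted d \<kappa> (w j)))) (shifted d \<alpha> j)))"
  by (simp add: alternant_def partition_point_def shifted_def)

lemma prod_at_partition_point_eq_0_iff:
  "(\<Prod>j\<in>{1..d}. ypow yvar (yvar (Suc (shifted d \<kappa> (w j)))) (shifted d \<alpha> j)) = 0 \<longleftrightarrow>
     \<not> (\<forall>j\<in>{1..d}. shifted d \<alpha> j \<le> shifted d \<kappa> (w j))"
  by (simp add: ypow_yvar_eq_0_iff not_le Bex_def)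

lemma alternant_vanishing:
  assumes \<alpha>: "\<alpha> \<in> partitions d" and \<kappa>: "\<kappa> \<in> partitions d"
    and nonzero: "alternant d yvar \<alpha> (\<lambda>_. 1) (partition_point d \<kappa>) \<noteq> 0" and j: "j \<in> {1..d}"
  shows "\<alpha> j \<le> \<kappa> j"
proof -
  have "\<exists>w. w permutes {1..d} \<and> (\<forall>j\<in>{1..d}. shifted d \<alpha> j \<le> shifted d \<kappa> (w j))"
  proof (rule ccontr)
    assume none: "\<not> ?thesis"
    have "alternant d yvar \<alpha> (\<lambda>_. 1) (partition_point d \<kappa>) = 0"
      unfolding alternant_at_partition_point
    proof (rule sum.neutral, rule ballI)
      fix w assume "w \<in> {w. w permutes {1..d}}"
      then have "(\<Prod>j\<in>{1..d}. ypow yvar (yvar (Suc (shifted d \<kappa> (w j)))) (shifted d \<alpha> j)) = 0"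
        unfolding prod_at_partition_point_eq_0_iff using none by blast
      then show "of_int (sign w) *
          (\<Prod>j\<in>{1..d}. ypow yvar (yvar (Suc (shifted d \<kappa> (w j)))) (shifted d \<alpha> j)) = 0"
        by (simp only: mult_zero_right)
    qed
    then show False
      using nonzero by contradiction
  qed
  then show ?thesis
    using dominated_if_permutation_dominated[OF \<alpha> \<kappa>] j by blast
qed

lemma alternant_nonzero:
  assumes \<kappa>: "\<kappa> \<in> partitions d"
  shows "alternant d yvar \<kappa> (\<lambda>_. 1) (partition_point d \<kappa>) \<noteq> 0"
proof -
  let ?p = "\<lambda>w. \<Prod>j\<in>{1..d}. ypow yvar (yvar (Suc (shifted d \<kappa> (w j)))) (shifted d \<kappa> j)"
  have "(\<Sum>w | w permutes {1..d}. of_int (sign w) * ?p w) = (\<Sum>w\<in>{id}. of_int (sign w) * ?p w)"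
  proof (rule sum.mono_neutral_right)
    show "\<forall>w\<in>{w. w permutes {1..d}} - {id}. of_int (sign w) * ?p w = 0"
    proof
      fix w assume w: "w \<in> {w. w permutes {1..d}} - {id}"
      then have "?p w = 0"
        unfolding prod_at_partition_point_eq_0_iff
        using permutation_dominated_self_imp_id[OF \<kappa>, of w] by blast
      then show "of_int (sign w) * ?p w = 0"
        by (simp only: mult_zero_right)
    qed
  qed (auto simp: finite_permutations permutes_id)
  moreover have "?p id \<noteq> 0"
    using prod_at_partition_point_eq_0_iff[of d \<kappa> id \<kappa>] by simp
  ultimately show ?thesis
    unfolding alternant_at_partition_point by simp
qed

lemma partition_ext:
  assumes "\<alpha> \<in> partitions d" "\<beta> \<in> partitions d" "\<And>j. j \<in> {1..d} \<Longrightarrow> \<alpha> j = \<beta> j"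
  shows "\<alpha> = \<beta>"
proof
  fix j
  show "\<alpha> j = \<beta> j"
    using assms by (cases "j \<in> {1..d}") (simp_all add: partitions_def)
qed

text \<open>Evaluate at the point of a partition \<open>\<kappa>\<close> of smallest size among those with nonzero coefficient: by
the vanishing property only the term of \<open>\<kappa>\<close> survives.\<close>

lemma alternants_independent:
  assumes fin: "finite P" and P: "P \<subseteq> partitions d"
    and zero: "(\<Sum>\<nu>\<in>P. const (c \<nu>) * alternant d (\<lambda>i. const (yvar i)) \<nu> (\<lambda>_. 1) xvar) = 0"
    and \<nu>: "\<nu> \<in> P"
  shows "c \<nu> = 0"
proof (rule ccontr)
  assume "c \<nu> \<noteq> 0"
  define Q where "Q = {\<nu> \<in> P. c \<nu> \<noteq> 0}"
  define size where "size = (\<lambda>\<nu>::nat \<Rightarrow> nat. \<Sum>j\<in>{1..d}. \<nu> j)"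
  have "\<nu> \<in> Q"
    using \<nu> \<open>c \<nu> \<noteq> 0\<close> by (simp add: Q_def)
  then obtain \<kappa> where \<kappa>: "\<kappa> \<in> Q" and min: "\<And>\<alpha>. \<alpha> \<in> Q \<Longrightarrow> size \<kappa> \<le> size \<alpha>"
    using ex_has_least_nat[of "\<lambda>\<alpha>. \<alpha> \<in> Q" \<nu> size] by blast
  have \<kappa>P: "\<kappa> \<in> P" "\<kappa> \<in> partitions d" "c \<kappa> \<noteq> 0"
    using \<kappa> P by (auto simp: Q_def)
  let ?A = "\<lambda>\<alpha>. alternant d yvar \<alpha> (\<lambda>_. 1) (partition_point d \<kappa>)"
  have "0 = eval_at (partition_point d \<kappa>)
      (\<Sum>\<nu>\<in>P. const (c \<nu>) * alternant d (\<lambda>i. const (yvar i)) \<nu> (\<lambda>_. 1) xvar)"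
    unfolding zero eval_at_zero ..
  also have "\<dots> = (\<Sum>\<alpha>\<in>P. c \<alpha> * ?A \<alpha>)"
    by (simp only: eval_at_sum eval_at_mult eval_at_const eval_at_alternant)
  also have "\<dots> = (\<Sum>\<alpha>\<in>{\<kappa>}. c \<alpha> * ?A \<alpha>)"
  proof (rule sum.mono_neutral_right[OF fin])
    show "\<forall>\<alpha>\<in>P - {\<kappa>}. c \<alpha> * ?A \<alpha> = 0"
    proof
      fix \<alpha> assume \<alpha>: "\<alpha> \<in> P - {\<kappa>}"
      show "c \<alpha> * ?A \<alpha> = 0"
      proof (rule ccontr)
        assume "c \<alpha> * ?A \<alpha> \<noteq> 0"
        then have nz: "c \<alpha> \<noteq> 0" "?A \<alpha> \<noteq> 0" by auto
        have \<alpha>p: "\<alpha> \<in> partitions d"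
          using \<alpha> P by blast
        have le: "\<alpha> j \<le> \<kappa> j" if "j \<in> {1..d}" for j
          by (rule alternant_vanishing[OF \<alpha>p \<kappa>P(2) nz(2) that])
        have "\<alpha> \<in> Q"
          using \<alpha> nz by (simp add: Q_def)
        then have "size \<kappa> \<le> size \<alpha>"
          by (rule min)
        have "\<alpha> j = \<kappa> j" if j: "j \<in> {1..d}" for j
        proof (rule ccontr)
          assume "\<alpha> j \<noteq> \<kappa> j"
          then have "\<alpha> j < \<kappa> j"
            using le[OF j] by simp
          then have "size \<alpha> < size \<kappa>"
            unfolding size_def using le j by (intro sum_strict_mono_ex1) auto
          then show False
            using \<open>size \<kappa> \<le> size \<alpha>\<close> by simp
        qed
        then have "\<alpha> = \<kappa>"
          by (rule partition_ext[OF \<alpha>p \<kappa>P(2)])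
        then show False
          using \<alpha> by simp
      qed
    qed
  qed (use \<kappa>P in simp)
  finally show False
    using alternant_nonzero[OF \<kappa>P(2)] \<kappa>P(3) by simp
qed

lemma vandermonde_nonzero:
  "alternant d (\<lambda>i. const (yvar i)) (\<lambda>_. 0) (\<lambda>_. 1) xvar \<noteq> 0"
proof
  assume zero: "alternant d (\<lambda>i. const (yvar i)) (\<lambda>_. 0) (\<lambda>_. 1) xvar = 0"
  have "alternant d yvar (\<lambda>_. 0) (\<lambda>_. 1) (partition_point d (\<lambda>_. 0)) = 0"
    unfolding eval_at_alternant[symmetric] zero eval_at_zero ..
  moreover have "(\<lambda>_. 0) \<in> partitions d"
    by (simp add: partitions_def)
  ultimately show False
    using alternant_nonzero by blast
qed

section \<open>Littlewood-Richardson skew tableaux\<close>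

definition before_ordinary :: "box \<Rightarrow> box \<Rightarrow> bool" where
  "before_ordinary = (\<lambda>(r, c) (r', c'). c' < c \<or> c = c' \<and> r < r')"

lemma sorted_reading_ordinary: "sorted_wrt before_ordinary (reading_ordinary d lam)"
proof -
  have inner: "sorted_wrt before_ordinary (concat (map (\<lambda>r. if c \<le> lam r then [(r, c)] else []) [1..<d + 1]))" for c
    by (rule sorted_wrt_concat)
      (auto simp: sorted_wrt_map before_ordinary_def simp del: upt_Suc
        intro!: sorted_wrt_mono_rel[OF _ sorted_wrt_upt] split: if_splits)
  show ?thesis
    unfolding reading_ordinary_def
    by (rule sorted_wrt_concat)
      (use inner in \<open>auto simp: sorted_wrt_map sorted_wrt_rev before_ordinary_def simp del: upt_Suc
        intro!: sorted_wrt_mono_rel[OF _ sorted_wrt_upt] split: if_splits\<close>)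
qed

lemma distinct_reading_ordinary: "distinct (reading_ordinary d lam)"
  by (rule distinct_if_sorted_wrt_irrefl[OF sorted_reading_ordinary]) (auto simp: before_ordinary_def)

lemma set_reading_ordinary:
  assumes "lam \<in> partitions d"
  shows "set (reading_ordinary d lam) = boxes d lam"
  using le_first_part[OF assms]
  by (fastforce simp: reading_ordinary_def boxes_def less_Suc_eq_le simp del: upt_Suc split: if_splits)

lemma reading_ordinary_split:
  assumes lam: "lam \<in> partitions d" and eq: "reading_ordinary d lam = ps @ (r, c) # rs"
  shows "set ps = {(r', c') \<in> boxes d lam. c < c' \<or> c' = c \<and> r' < r}"
proof -
  have all: "boxes d lam = set ps \<union> {(r, c)} \<union> set rs"
    using set_reading_ordinary[OF lam] eq by auto
  have "before_ordinary b (r, c)" if "b \<in> set ps" for b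
    using sorted_reading_ordinary[of d lam] that unfolding eq by (auto simp: sorted_wrt_append)
  moreover have "before_ordinary (r, c) b" if "b \<in> set rs" for b
    using sorted_reading_ordinary[of d lam] that unfolding eq by (auto simp: sorted_wrt_append)
  ultimately show ?thesis
    unfolding all by (fastforce simp: before_ordinary_def)
qed

text \<open>The only filling of the ordinary diagram with Yamanouchi word: row \<open>i\<close> consists of \<open>i\<close>'s.\<close>

definition row_filling :: "nat \<Rightarrow> (nat \<Rightarrow> nat) \<Rightarrow> box \<Rightarrow> nat" where
  "row_filling d lam = (\<lambda>b\<in>boxes d lam. fst b)"

lemma row_filling_in: "row_filling d lam \<in> boxes d lam \<rightarrow>\<^sub>E {1..d}"
  by (auto simp: row_filling_def boxes_def)

lemma row_filling_increasing: "increasing_ordinary (boxes d lam) (row_filling d lam)"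
  by (auto simp: increasing_ordinary_def row_filling_def)

lemma row_filling_content:
  assumes lam: "lam \<in> partitions d"
  shows "count_list (map (row_filling d lam) (reading_ordinary d lam)) = lam"
proof
  fix i
  have "{b \<in> boxes d lam. row_filling d lam b = i} = (if i \<in> {1..d} then Pair i ` {1..lam i} else {})"
    by (auto simp: row_filling_def boxes_def)
  moreover have "lam i = 0" if "i \<notin> {1..d}"
    using lam that by (simp add: partitions_def)
  ultimately show "count_list (map (row_filling d lam) (reading_ordinary d lam)) i = lam i"
    by (simp add: count_list_map_eq_card[OF distinct_reading_ordinary] set_reading_ordinary[OF lam]
        card_image inj_on_def split: if_splits)
qed

lemma row_filling_yamanouchi:
  assumes lam: "lam \<in> partitions d"
  shows "yamanouchi d (map (row_filling d lam) (reading_ordinary d lam))"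
  unfolding yamanouchi_def
proof (intro allI impI ballI)
  fix u k
  assume u: "prefix u (map (row_filling d lam) (reading_ordinary d lam))" and k: "k \<in> {1..<d}"
  obtain qs where qs: "prefix qs (reading_ordinary d lam)" and u_eq: "u = map (row_filling d lam) qs"
    using u by (auto simp: prefix_map_rightE dest: prefix_map_rightE)
  obtain rs where eq: "reading_ordinary d lam = qs @ rs"
    using qs by (auto simp: prefix_def)
  have dist: "distinct qs"
    using distinct_reading_ordinary[of d lam] eq by simp
  have D: "boxes d lam = set qs \<union> set rs"
    using set_reading_ordinary[OF lam] eq by simp
  have before: "before_ordinary b b'" if "b \<in> set qs" "b' \<in> set rs" for b b'
    using sorted_reading_ordinary[of d lam] that unfolding eq by (simp add: sorted_wrt_append)
  have "card {b \<in> set qs. row_filling d lam b = k + 1} \<le> card {b \<in> set qs. row_filling d lam b = k}"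
  proof (rule card_inj_on_le)
    show "inj_on (\<lambda>(r, c). (k, c)) {b \<in> set qs. row_filling d lam b = k + 1}"
      using D by (auto simp: inj_on_def row_filling_def)
    show "(\<lambda>(r, c). (k, c)) ` {b \<in> set qs. row_filling d lam b = k + 1} \<subseteq> {b \<in> set qs. row_filling d lam b = k}"
    proof (rule image_subsetI)
      fix b assume b: "b \<in> {b \<in> set qs. row_filling d lam b = k + 1}"
      obtain r c where rc: "b = (r, c)" by fastforce
      have in_D: "(r, c) \<in> boxes d lam" and in_qs: "(r, c) \<in> set qs"
        using b D by (auto simp: rc)
      have r: "r = k + 1"
        using b in_D by (simp add: rc row_filling_def)
      have D': "(k, c) \<in> boxes d lam"
        by (rule boxes_downward_closed[OF lam in_D]) (use k r in_D in \<open>auto simp: boxes_def\<close>)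
      have "(k, c) \<notin> set rs"
        using before[OF in_qs, of "(k, c)"] r by (auto simp: before_ordinary_def)
      then have "(k, c) \<in> set qs"
        using D D' by blast
      then show "(case b of (r, c) \<Rightarrow> (k, c)) \<in> {b \<in> set qs. row_filling d lam b = k}"
        using D' by (simp add: rc row_filling_def)
    qed
  qed simp
  then show "count_list u (k + 1) \<le> count_list u k"
    unfolding u_eq count_list_map_eq_card[OF dist] .
qed

text \<open>Suppose that all boxes read before \<open>(r, c)\<close> carry their row number. The entry of \<open>(r, c)\<close> is at least
\<open>r\<close> by column strictness. If the row continues to the right, it is at most \<open>r\<close> by the neighbour
there. Otherwise all boxes read so far lie in rows above \<open>r\<close>, so a larger entry \<open>a\<close> would occur
before any \<open>a - 1\<close> does.\<close>

lemma yamanouchi_imp_row_filling: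
  assumes lam: "lam \<in> partitions d" and T: "T \<in> boxes d lam \<rightarrow>\<^sub>E {1..d}"
    and incr: "increasing_ordinary (boxes d lam) T"
    and yam: "yamanouchi d (map T (reading_ordinary d lam))"
  shows "T = row_filling d lam"
proof -
  have "prefix ps (reading_ordinary d lam) \<Longrightarrow> \<forall>b\<in>set ps. T b = fst b" for ps
  proof (induction ps rule: rev_induct)
    case (snoc b ps)
    obtain r c where rc: "b = (r, c)" by fastforce
    obtain rs where eq: "reading_ordinary d lam = ps @ (r, c) # rs"
      using snoc.prems by (auto simp: prefix_def rc)
    have IH: "\<forall>b\<in>set ps. T b = fst b"
      by (rule snoc.IH[OF append_prefixD[OF snoc.prems]])
    have ps: "set ps = {(r', c') \<in> boxes d lam. c < c' \<or> c' = c \<and> r' < r}"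
      by (rule reading_ordinary_split[OF lam eq])
    have D: "(r, c) \<in> boxes d lam"
      using set_reading_ordinary[OF lam] eq by auto
    then have pos: "1 \<le> r" "1 \<le> c" "r \<le> d" "c \<le> lam r"
      by (auto simp: boxes_def)
    have Tb: "1 \<le> T (r, c)" "T (r, c) \<le> d"
      using PiE_mem[OF T D] by auto
    have ge: "r \<le> T (r, c)"
    proof (cases "r = 1")
      case False
      have D': "(r - 1, c) \<in> boxes d lam"
        by (rule boxes_downward_closed[OF lam D]) (use False pos in auto)
      then have "(r - 1, c) \<in> set ps"
        using ps pos by simp
      then have "T (r - 1, c) = r - 1"
        using IH by fastforce
      moreover have "T (r - 1, c) < T (r, c)"
        using incr D D' pos unfolding increasing_ordinary_def by simp
      ultimately show ?thesis by simp
    qed (use Tb in simp)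
    have "\<not> r < T (r, c)"
    proof
      assume less: "r < T (r, c)"
      have c: "c = lam r"
      proof (rule ccontr)
        assume "c \<noteq> lam r"
        then have D': "(r, c + 1) \<in> boxes d lam"
          using pos by (simp add: boxes_def)
        then have "(r, c + 1) \<in> set ps"
          using ps by simp
        then have "T (r, c + 1) = r"
          using IH by fastforce
        moreover have "T (r, c) \<le> T (r, c + 1)"
          using incr D D' unfolding increasing_ordinary_def by simp
        ultimately show False
          using less by simp
      qed
      \<comment> \<open>Here \<open>c\<close> is the last column of row \<open>r\<close>, so rows that reach a later column lie above.\<close>
      have small: "T b' < r" if "b' \<in> set ps" for b'
      proof -
        obtain r' c' where rc': "b' = (r', c')" by fastforce
        have b': "(r', c') \<in> boxes d lam" "c < c' \<or> c' = c \<and> r' < r"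
          using that ps by (auto simp: rc')
        have "r' < r"
        proof (rule ccontr)
          assume "\<not> r' < r"
          then have "lam r' \<le> lam r"
            using lam b'(1) pos by (auto simp: partitions_def boxes_def)
          then show False
            using b' \<open>\<not> r' < r\<close> c by (auto simp: boxes_def)
        qed
        then show ?thesis
          using IH that by (auto simp: rc')
      qed
      let ?k = "T (r, c) - 1"
      let ?u = "map T (ps @ [(r, c)])"
      have "prefix ?u (map T (reading_ordinary d lam))"
        unfolding eq by simp
      moreover have "?k \<in> {1..<d}"
        using less pos Tb by auto
      ultimately have "count_list ?u (?k + 1) \<le> count_list ?u ?k"
        using yam unfolding yamanouchi_def by blast
      moreover have "count_list ?u ?k = 0"
        using small less by (fastforce simp: count_list_0_iff)
      moreover have "?k + 1 = T (r, c)"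
        using Tb by simp
      ultimately show False by simp
    qed
    then have "T (r, c) = r"
      using ge by simp
    then show ?case
      using IH by (simp add: rc)
  qed simp
  then have "\<forall>b\<in>boxes d lam. T b = fst b"
    using set_reading_ordinary[OF lam] by blast
  then show ?thesis
    using T row_filling_in[of d lam]
    by (intro extensionalityI[where A = "boxes d lam"]) (auto simp: row_filling_def PiE_def)
qed

lemma prefix_unbarred_entries:
  assumes "prefix v (unbarred_entries U bs)"
  shows "\<exists>qs. prefix qs bs \<and> v = unbarred_entries U qs"
  using assms
proof (induction bs rule: rev_induct)
  case Nil
  then show ?case
    by (intro exI[of _ "[]"]) (simp add: unbarred_entries_def)
next
  case (snoc b bs)
  have split: "unbarred_entries U (bs @ [b]) =
      unbarred_entries U bs @ (if is_barred (U b) then [] else [value_of (U b)])"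
    by (simp add: unbarred_entries_def)
  consider "prefix v (unbarred_entries U bs)" | "v = unbarred_entries U (bs @ [b])"
    using snoc.prems unfolding split by (cases "is_barred (U b)") (auto simp: prefix_snoc)
  then show ?case
  proof cases
    case 1
    then obtain qs where "prefix qs bs" "v = unbarred_entries U qs"
      using snoc.IH by blast
    then show ?thesis
      by (intro exI[of _ qs]) (simp add: prefix_snoc)
  next
    case 2
    then show ?thesis by blast
  qed
qed

lemma unbarred_entries_mono_prefix:
  "prefix qs bs \<Longrightarrow> prefix (unbarred_entries U qs) (unbarred_entries U bs)"
  by (auto simp: prefix_def unbarred_entries_def)

text \<open>The first part of the word has content \<open>lam\<close>, so the contents of the longer prefixes are the shapes
reached while reading \<open>U\<close>.\<close>

lemma yamanouchi_iff_dominant: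
  assumes lam: "lam \<in> partitions d" and U: "U \<in> set bs \<rightarrow>\<^sub>E entries d"
  shows "yamanouchi d (map (row_filling d lam) (reading_ordinary d lam) @ unbarred_entries U bs) \<longleftrightarrow>
           dominant d lam U bs"
proof -
  let ?A = "map (row_filling d lam) (reading_ordinary d lam)"
  have count: "count_list (?A @ unbarred_entries U qs) i = shape_after lam U qs i" for qs i
    by (simp only: count_list_append row_filling_content[OF lam] shape_after_def)
  show ?thesis
  proof
    assume yam: "yamanouchi d (?A @ unbarred_entries U bs)"
    show "dominant d lam U bs"
      unfolding dominant_def
    proof (intro allI impI partitionsI)
      fix qs i assume qs: "prefix qs bs" and i: "1 \<le> i" "Suc i \<le> d"
      have "prefix (?A @ unbarred_entries U qs) (?A @ unbarred_entries U bs)"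
        using unbarred_entries_mono_prefix[OF qs] by simp
      then have "count_list (?A @ unbarred_entries U qs) (i + 1) \<le> count_list (?A @ unbarred_entries U qs) i"
        using yam i unfolding yamanouchi_def by (meson atLeastLessThan_iff Suc_le_eq)
      then show "shape_after lam U qs (Suc i) \<le> shape_after lam U qs i"
        unfolding count by simp
    next
      fix qs i assume qs: "prefix qs bs" and i: "i \<notin> {1..d}"
      have "value_of (U b) \<in> {1..d}" if "b \<in> set qs" for b
      proof -
        have "U b \<in> entries d"
          using PiE_mem[OF U, of b] set_mono_prefix[OF qs] that by blast
        then show ?thesis by auto
      qed
      then have "i \<notin> set (unbarred_entries U qs)"
        using i by (auto simp: unbarred_entries_def)
      moreover have "lam i = 0"
        using lam i by (simp add: partitions_def)
      ultimately show "shape_after lam U qs i = 0"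
        by (simp add: shape_after_def count_list_0_iff)
    qed
  next
    assume dom: "dominant d lam U bs"
    show "yamanouchi d (?A @ unbarred_entries U bs)"
      unfolding yamanouchi_def
    proof (intro allI impI ballI)
      fix u k assume u: "prefix u (?A @ unbarred_entries U bs)" and k: "k \<in> {1..<d}"
      consider "prefix u ?A" | v where "u = ?A @ v" "prefix v (unbarred_entries U bs)"
        using u by (auto simp: prefix_append)
      then show "count_list u (k + 1) \<le> count_list u k"
      proof cases
        case 1
        then show ?thesis
          using row_filling_yamanouchi[OF lam] k unfolding yamanouchi_def by blast
      next
        case 2
        obtain qs where qs: "prefix qs bs" "v = unbarred_entries U qs"
          using prefix_unbarred_entries[OF 2(2)] by blast
        have "shape_after lam U qs \<in> partitions d"
          using dom qs(1) by (simp add: dominant_def)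
        then have "shape_after lam U qs (k + 1) \<le> shape_after lam U qs k"
          using k by (simp add: partitions_def)
        then show ?thesis
          unfolding 2(1) qs(2) count .
      qed
    qed
  qed
qed

lemma LR_tableaux_eq:
  assumes lam: "lam \<in> partitions d" and \<mu>: "\<mu> \<in> partitions d"
  shows "LR_tableaux d lam \<mu> \<nu> = Pair (row_filling d lam) `
     {U \<in> dominant_fillings d lam \<mu>. shape_after lam U (reading_reverse d \<mu>) = \<nu>}"
proof -
  let ?A = "map (row_filling d lam) (reading_ordinary d lam)" and ?bs = "reading_reverse d \<mu>"
  have word: "unbarred_word d lam \<mu> (row_filling d lam, U) = ?A @ unbarred_entries U ?bs" for U
    by (simp add: unbarred_word_def)
  have content: "count_list (?A @ unbarred_entries U ?bs) = shape_after lam U ?bs" for U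
    by (rule ext) (simp only: count_list_append row_filling_content[OF lam] shape_after_def)
  have iff: "(row_filling d lam, U) \<in> LR_tableaux d lam \<mu> \<nu> \<longleftrightarrow>
      U \<in> dominant_fillings d lam \<mu> \<and> shape_after lam U ?bs = \<nu>" for U
  proof (cases "U \<in> boxes d \<mu> \<rightarrow>\<^sub>E entries d")
    case True
    then have "yamanouchi d (?A @ unbarred_entries U ?bs) \<longleftrightarrow> dominant d lam U ?bs"
      by (intro yamanouchi_iff_dominant[OF lam]) (simp only: set_reading_reverse[OF \<mu>])
    then show ?thesis
      using True row_filling_in[of d lam] row_filling_increasing[of d lam]
      by (simp only: LR_tableaux_def skew_barred_tableaux_def dominant_fillings_def mem_Collect_eq
          case_prod_conv word content simp_thms conj_assoc)
  next
    case False
    then show ?thesis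
      by (simp only: LR_tableaux_def skew_barred_tableaux_def dominant_fillings_def mem_Collect_eq
          case_prod_conv simp_thms)
  qed
  have first: "T = row_filling d lam" if "(T, U) \<in> LR_tableaux d lam \<mu> \<nu>" for T U
  proof (rule yamanouchi_imp_row_filling[OF lam])
    have "yamanouchi d (map T (reading_ordinary d lam) @ unbarred_entries U ?bs)"
      using that by (simp add: LR_tableaux_def unbarred_word_def)
    then show "yamanouchi d (map T (reading_ordinary d lam))"
      unfolding yamanouchi_def by (metis prefix_append)
  qed (use that in \<open>auto simp: LR_tableaux_def skew_barred_tableaux_def\<close>)
  show ?thesis
  proof (intro set_eqI iffI)
    fix L assume L: "L \<in> LR_tableaux d lam \<mu> \<nu>"
    then obtain U where "L = (row_filling d lam, U)"
      using first[of "fst L" "snd L"] by (metis prod.collapse)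
    then show "L \<in> Pair (row_filling d lam) `
        {U \<in> dominant_fillings d lam \<mu>. shape_after lam U ?bs = \<nu>}"
      using L iff by blast
  qed (use iff in blast)
qed

lemma tableau_weight_row_filling:
  assumes lam: "lam \<in> partitions d" and \<mu>: "\<mu> \<in> partitions d"
  shows "tableau_weight d lam \<mu> (row_filling d lam, U) = bar_weight d yvar lam U (reading_reverse d \<mu>)"
proof -
  have "count_list (unbarred_word_before d lam \<mu> (row_filling d lam, U) b) a =
      shape_after lam U (takeWhile (\<lambda>b'. b' \<noteq> b) (reading_reverse d \<mu>)) a" for a b
    unfolding unbarred_word_before_def
    by (simp only: case_prod_conv count_list_append row_filling_content[OF lam] shape_after_def)
  then show ?thesis
    by (simp add: tableau_weight_def bar_weight_def set_reading_reverse[OF \<mu>] Let_def)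
qed

lemma const_mult: "const (p * q) = const p * const q"
  by (simp add: const_def mult_single)

lemma const_diff: "const (p - q) = const p - const q"
  by (simp add: const_def single_diff)

lemma const_zero: "const 0 = 0"
  by (simp add: const_def)

lemma const_one: "const 1 = 1"
  by (simp add: const_def)

lemma const_sum: "const (\<Sum>i\<in>I. f i) = (\<Sum>i\<in>I. const (f i))"
  by (induction I rule: infinite_finite_induct) (simp_all add: const_def single_add)

lemma const_prod: "const (\<Prod>i\<in>I. f i) = (\<Prod>i\<in>I. const (f i))"
  by (induction I rule: infinite_finite_induct) (simp_all add: const_mult const_one)

lemma const_bar_weight:
  "const (bar_weight d yvar lam U ps) = bar_weight d (\<lambda>i. const (yvar i)) lam U ps"
  unfolding bar_weight_def const_prod const_diff ..

lemma factorial_schur_eq_schur: "factorial_schur d \<mu> = schur d \<mu> (\<lambda>i. const (yvar i)) xvar"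
  by (simp add: factorial_schur_def schur_def)

lemma dominant_fillings_shape:
  "U \<in> dominant_fillings d lam \<mu> \<Longrightarrow> shape_after lam U (reading_reverse d \<mu>) \<in> partitions d"
  by (auto simp: dominant_fillings_def dominant_def)

text \<open>All equalities are multiplied by \<open>A\<^sub>0\<close>, which is not a zero divisor.\<close>

lemma schur_product:
  assumes lam: "lam \<in> partitions d" and \<mu>: "\<mu> \<in> partitions d"
  shows "factorial_schur d lam * factorial_schur d \<mu> =
     (\<Sum>U\<in>dominant_fillings d lam \<mu>. const (bar_weight d yvar lam U (reading_reverse d \<mu>)) *
        factorial_schur d (shape_after lam U (reading_reverse d \<mu>)))"
proof -
  let ?Y = "\<lambda>i. const (yvar i)" and ?bs = "reading_reverse d \<mu>"
  let ?V = "alternant d ?Y (\<lambda>_. 0) (\<lambda>_. 1) xvar"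
  have "?V * (factorial_schur d lam * factorial_schur d \<mu>) =
      alternant d ?Y lam (\<lambda>_. 1) xvar * schur d \<mu> ?Y xvar"
    unfolding factorial_schur_eq_schur mult.assoc[symmetric] bialternant[OF lam] ..
  also have "\<dots> = alternant d ?Y lam (schur d \<mu> ?Y) xvar"
    by (rule alternant_symmetric[symmetric], rule schur_symmetric[OF \<mu>])
  also have "\<dots> = (\<Sum>U\<in>dominant_fillings d lam \<mu>. bar_weight d ?Y lam U ?bs *
      alternant d ?Y (shape_after lam U ?bs) (\<lambda>_. 1) xvar)"
    by (rule alternant_schur_expansion[OF lam \<mu>])
  also have "\<dots> = (\<Sum>U\<in>dominant_fillings d lam \<mu>. ?V * (const (bar_weight d yvar lam U ?bs) *
      factorial_schur d (shape_after lam U ?bs)))"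
  proof (rule sum.cong[OF refl])
    fix U assume "U \<in> dominant_fillings d lam \<mu>"
    note B = bialternant[OF dominant_fillings_shape[OF this], of ?Y xvar]
    show "bar_weight d ?Y lam U ?bs * alternant d ?Y (shape_after lam U ?bs) (\<lambda>_. 1) xvar =
        ?V * (const (bar_weight d yvar lam U ?bs) * factorial_schur d (shape_after lam U ?bs))"
      unfolding factorial_schur_eq_schur const_bar_weight B[symmetric] by (rule mult.left_commute)
  qed
  finally show ?thesis
    unfolding sum_distrib_left[symmetric] mult_cancel_left using vandermonde_nonzero by blast
qed

lemma factorial_schur_independent:
  assumes fin: "finite P" and P: "P \<subseteq> partitions d"
    and eq: "(\<Sum>\<nu>\<in>P. const (c \<nu>) * factorial_schur d \<nu>) = (\<Sum>\<nu>\<in>P. const (c' \<nu>) * factorial_schur d \<nu>)"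
    and \<nu>: "\<nu> \<in> P"
  shows "c \<nu> = c' \<nu>"
proof -
  let ?Y = "\<lambda>i. const (yvar i)"
  let ?V = "alternant d ?Y (\<lambda>_. 0) (\<lambda>_. 1) xvar"
  have scaled: "?V * (const (c \<nu> - c' \<nu>) * factorial_schur d \<nu>) =
      const (c \<nu> - c' \<nu>) * alternant d ?Y \<nu> (\<lambda>_. 1) xvar" if "\<nu> \<in> P" for \<nu>
  proof -
    have "\<nu> \<in> partitions d"
      using that P by blast
    from bialternant[OF this, of ?Y xvar] show ?thesis
      unfolding factorial_schur_eq_schur by (subst mult.left_commute) (rule arg_cong)
  qed
  have "(\<Sum>\<nu>\<in>P. const (c \<nu> - c' \<nu>) * factorial_schur d \<nu>) = 0"
    by (simp add: const_diff left_diff_distrib sum_subtractf eq)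
  then have "?V * (\<Sum>\<nu>\<in>P. const (c \<nu> - c' \<nu>) * factorial_schur d \<nu>) = 0"
    by simp
  then have "(\<Sum>\<nu>\<in>P. const (c \<nu> - c' \<nu>) * alternant d ?Y \<nu> (\<lambda>_. 1) xvar) = 0"
    unfolding sum_distrib_left using sum.cong[OF refl scaled, of P] by (rule trans[OF sym, rotated])
  then have "c \<nu> - c' \<nu> = 0"
    by (rule alternants_independent[OF fin P _ \<nu>])
  then show ?thesis by simp
qed

lemma structure_constant_eqI:
  assumes fin: "finite {\<nu>. c \<nu> \<noteq> 0}" and sub: "{\<nu>. c \<nu> \<noteq> 0} \<subseteq> partitions d"
    and eq: "factorial_schur d lam * factorial_schur d \<mu> =
      (\<Sum>\<nu> | c \<nu> \<noteq> 0. const (c \<nu>) * factorial_schur d \<nu>)"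
  shows "structure_constant d lam \<mu> = c"
  unfolding structure_constant_def
proof (rule the_equality)
  fix c' :: "(nat \<Rightarrow> nat) \<Rightarrow> ypoly"
  assume c': "finite {\<nu>. c' \<nu> \<noteq> 0} \<and> {\<nu>. c' \<nu> \<noteq> 0} \<subseteq> partitions d \<and>
      factorial_schur d lam * factorial_schur d \<mu> =
        (\<Sum>\<nu> | c' \<nu> \<noteq> 0. const (c' \<nu>) * factorial_schur d \<nu>)"
  let ?P = "{\<nu>. c \<nu> \<noteq> 0} \<union> {\<nu>. c' \<nu> \<noteq> 0}"
  have P: "finite ?P" "?P \<subseteq> partitions d"
    using fin sub c' by auto
  have extend: "(\<Sum>\<nu> | f \<nu> \<noteq> 0. const (f \<nu>) * factorial_schur d \<nu>) =
      (\<Sum>\<nu>\<in>?P. const (f \<nu>) * factorial_schur d \<nu>)" if "{\<nu>. f \<nu> \<noteq> 0} \<subseteq> ?P" for f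
    using P(1) that by (intro sum.mono_neutral_left) (auto simp: const_zero)
  have "(\<Sum>\<nu>\<in>?P. const (c' \<nu>) * factorial_schur d \<nu>) = (\<Sum>\<nu>\<in>?P. const (c \<nu>) * factorial_schur d \<nu>)"
    using extend[of c] extend[of c'] eq c' by simp
  then have on_P: "c' \<nu> = c \<nu>" if "\<nu> \<in> ?P" for \<nu>
    by (rule factorial_schur_independent[OF P _ that])
  show "c' = c"
  proof (intro ext)
    fix \<nu>
    show "c' \<nu> = c \<nu>"
      using on_P[of \<nu>] by (cases "\<nu> \<in> ?P") simp_all
  qed
qed (use fin sub eq in blast)

theorem theorem2p4:
  fixes d :: nat and lam \<mu> \<nu> :: "nat \<Rightarrow> nat"
  assumes "d \<ge> 1" and "lam \<in> partitions d" and "\<mu> \<in> partitions d" and "\<nu> \<in> partitions d"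
  shows "structure_constant d lam \<mu> \<nu> = (\<Sum>L\<in>LR_tableaux d lam \<mu> \<nu>. tableau_weight d lam \<mu> L)"
proof -
  note lam = assms(2) and \<mu> = assms(3)
  let ?bs = "reading_reverse d \<mu>" and ?DF = "dominant_fillings d lam \<mu>"
  let ?shape = "\<lambda>U. shape_after lam U ?bs" and ?w = "\<lambda>U. bar_weight d yvar lam U ?bs"
  define c where "c \<nu> = (\<Sum>U\<in>{U \<in> ?DF. ?shape U = \<nu>}. ?w U)" for \<nu>
  have support: "{\<nu>. c \<nu> \<noteq> 0} \<subseteq> ?shape ` ?DF"
  proof
    fix \<nu> assume "\<nu> \<in> {\<nu>. c \<nu> \<noteq> 0}"
    then have "{U \<in> ?DF. ?shape U = \<nu>} \<noteq> {}"
      unfolding c_def by (metis (mono_tags, lifting) mem_Collect_eq sum.empty)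
    then show "\<nu> \<in> ?shape ` ?DF" by blast
  qed
  have fin: "finite (?shape ` ?DF)"
    by (simp add: finite_dominant_fillings)
  have "structure_constant d lam \<mu> = c"
  proof (rule structure_constant_eqI)
    show "finite {\<nu>. c \<nu> \<noteq> 0}"
      by (rule finite_subset[OF support fin])
    show "{\<nu>. c \<nu> \<noteq> 0} \<subseteq> partitions d"
      using support dominant_fillings_shape by blast
    have "factorial_schur d lam * factorial_schur d \<mu> =
        (\<Sum>U\<in>?DF. const (?w U) * factorial_schur d (?shape U))"
      by (rule schur_product[OF lam \<mu>])
    also have "\<dots> = (\<Sum>\<nu>\<in>?shape ` ?DF. \<Sum>U\<in>{U \<in> ?DF. ?shape U = \<nu>}.
        const (?w U) * factorial_schur d (?shape U))"
      by (rule sum.image_gen[OF finite_dominant_fillings])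
    also have "\<dots> = (\<Sum>\<nu>\<in>?shape ` ?DF. const (c \<nu>) * factorial_schur d \<nu>)"
      unfolding c_def const_sum sum_distrib_right by (intro sum.cong refl) simp
    also have "\<dots> = (\<Sum>\<nu> | c \<nu> \<noteq> 0. const (c \<nu>) * factorial_schur d \<nu>)"
      by (rule sum.mono_neutral_right[OF fin support]) (simp add: const_zero)
    finally show "factorial_schur d lam * factorial_schur d \<mu> =
        (\<Sum>\<nu> | c \<nu> \<noteq> 0. const (c \<nu>) * factorial_schur d \<nu>)" .
  qed
  moreover have "(\<Sum>L\<in>LR_tableaux d lam \<mu> \<nu>. tableau_weight d lam \<mu> L) = c \<nu>"
    unfolding LR_tableaux_eq[OF lam \<mu>] c_def
    by (subst sum.reindex) (simp_all add: inj_on_def tableau_weight_row_filling[OF lam \<mu>])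
  ultimately show ?thesis by simp
qed

end
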